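(* The coefficient functions satisfy the coupled linear recurrence relations (the first four for $n\ge1$, the last four for $n\ge0$) $$\Omega_n(z)+\Omega_{n-1}(z)-\left(\frac{\phi_{n+1}(0)}{\phi_n(0)}+\frac{\kappa_{n+1}}{\kappa_n}z\right)\Theta_n(z)+(n-1)\frac{W(z)}{z}=0,$$ $$\left(\frac{\phi_{n+1}(0)}{\phi_n(0)}+\frac{\kappa_{n+1}}{\kappa_n}z\right)(\Omega_{n-1}(z)-\Omega_n(z))+\frac{\kappa_n\phi_{n+2}(0)}{\kappa_{n+1}\phi_{n+1}(0)}z\Theta_{n+1}(z)-\frac{\kappa_{n-1}\phi_{n+1}(0)}{\kappa_n\phi_n(0)}z\Theta_{n-1}(z)-\frac{\phi_{n+1}(0)}{\phi_n(0)}\frac{W(z)}{z}=0,$$ $$\Omega^*_n(z)+\Omega^*_{n-1}(z)-\left(\frac{\kappa_{n+1}}{\kappa_n}+\frac{\bar\phi_{n+1}(0)}{\bar\phi_n(0)}z\right)\Theta^*_n(z)-n\frac{W(z)}{z}=0,$$ $$\left(\frac{\kappa_{n+1}}{\kappa_n}+\frac{\bar\phi_{n+1}(0)}{\bar\phi_n(0)}z\right)(\Omega^*_{n-1}(z)-\Omega^*_n(z))+\frac{\kappa_n\bar\phi_{n+2}(0)}{\kappa_{n+1}\bar\phi_{n+1}(0)}z\Theta^*_{n+1}(z)-\frac{\kappa_{n-1}\bar\phi_{n+1}(0)}{\kappa_n\bar\phi_n(0)}z\Theta^*_{n-1}(z)+\frac{\kappa_{n+1}}{\kappa_n}\frac{W(z)}{z}=0,$$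 $$\Omega_{n+1}(z)+\Omega^*_n(z)-\left(\frac{\phi_{n+2}(0)}{\phi_{n+1}(0)}+\frac{\kappa_{n+2}}{\kappa_{n+1}}z\right)\Theta_{n+1}(z)+\frac{\kappa_{n+1}}{\kappa_n}(z\Theta_n(z)-\Theta^*_n(z))=0,$$ $$\Omega_n(z)-\Omega_{n+1}(z)+\frac{\kappa_{n+2}}{\kappa_{n+1}}\left(z+\frac{\bar\phi_{n+1}(0)}{\kappa_{n+1}}\frac{\phi_{n+2}(0)}{\kappa_{n+2}}\right)\Theta_{n+1}(z)+\frac{\phi_{n+1}(0)\bar\phi_{n+1}(0)}{\kappa_{n+1}\kappa_n}\Theta^*_n(z)-\frac{\kappa_{n+1}}{\kappa_n}z\Theta_n(z)-\frac{W(z)}{z}=0,$$ $$\Omega^*_{n+1}(z)+\Omega_n(z)-\left(\frac{\kappa_{n+2}}{\kappa_{n+1}}+\frac{\bar\phi_{n+2}(0)}{\bar\phi_{n+1}(0)}z\right)\Theta^*_{n+1}(z)-\frac{\kappa_{n+1}}{\kappa_n}(z\Theta_n(z)-\Theta^*_n(z))-\frac{W(z)}{z}=0,$$ $$\Omega^*_n(z)-\Omega^*_{n+1}(z)+\frac{\kappa_{n+2}}{\kappa_{n+1}}\left(1+\frac{\phi_{n+1}(0)}{\kappa_{n+1}}\frac{\bar\phi_{n+2}(0)}{\kappa_{n+2}}z\right)\Theta^*_{n+1}(z)+\frac{\phi_{n+1}(0)\bar\phi_{n+1}(0)}{\kappa_{n+1}\kappa_n}z\Theta_n(z)-\frac{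\kappa_{n+1}}{\kappa_n}\Theta^*_n(z)=0.$$
   Context: Let $\mathbb T=\{\zeta\in\mathbb C:|\zeta|=1\}$, $\zeta=e^{i\theta}$, $\theta\in(-\pi,\pi]$. The weight $w$ is a complex (not necessarily real or positive) function, analytic in a cut complex plane, with $z^jw,z^jw'\in L^1(\mathbb T)$ for all $j\in\mathbb Z$ and with expansion $w(z)=\sum_{k\in\mathbb Z}w_kz^k$, $w_k=\int_{\mathbb T}\frac{d\zeta}{2\pi i\zeta}w(\zeta)\zeta^{-k}$, converging in an annulus containing $\mathbb T$. Assume $\det[w_{j-k}]_{0\le j,k\le n-1}\ne0$ for all $n\ge1$. The bi-orthonormal polynomials are $\phi_n(z)=\kappa_nz^n+\dots+\phi_n(0)$ and $\bar\phi_n(z)=\kappa_nz^n+\dots+\bar\phi_n(0)$, of degree $n$ with the same leading coefficient $\kappa_n\ne0$, satisfying $\int_{\mathbb T}\frac{d\zeta}{2\pi i\zeta}w(\zeta)\phi_m(\zeta)\bar\phi_n(\bar\zeta)=\delta_{m,n}$ with $\bar\zeta=\zeta^{-1}$ on $\mathbb T$; the bar on $\bar\phi_n$ is notation and does not denote complex conjugation. The reciprocal polynomial is $\phi^*_n(z)=z^n\bar\phi_n(1/z)$. It is assumed that $\phi_n(0)\neq0$ and $\bar\phi_n(0)\ne0$ for all $n$. With $F(z)=\int_{\mathbb T}\frac{d\zeta}{2\pi i\zeta}\frac{\zeta+z}{\zeta-z}w(\zeta)$, the associated functions, defined for $z\notin\mathbb T$, are $\epsilon_n(z)=\int_{\mathbb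 T}\frac{d\zeta}{2\pi i\zeta}\frac{\zeta+z}{\zeta-z}w(\zeta)\phi_n(\zeta)$ and $\epsilon^*_n(z)=-z^n\int_{\mathbb T}\frac{d\zeta}{2\pi i\zeta}\frac{\zeta+z}{\zeta-z}w(\zeta)\bar\phi_n(\bar\zeta)$ for $n\ge1$, and $\epsilon_0=1/\kappa_0+\kappa_0F$, $\epsilon^*_0=1/\kappa_0-\kappa_0F$. $W(z)\not\equiv0$ and $V(z)$ are functions independent of $n$ with $Ww'=2Vw$, and the coefficient functions $\Theta_n,\Omega_n,\Theta^*_n,\Omega^*_n$ ($n\ge0$) are the functions determined by the relations $W\phi'_n=\Theta_n\phi_{n+1}-(\Omega_n+V)\phi_n$, $W\epsilon'_n=\Theta_n\epsilon_{n+1}-(\Omega_n-V)\epsilon_n$, $W\phi^{*\prime}_n=-\Theta^*_n\phi^*_{n+1}+(\Omega^*_n-V)\phi^*_n$, $W\epsilon^{*\prime}_n=-\Theta^*_n\epsilon^*_{n+1}+(\Omega^*_n+V)\epsilon^*_n$ (here $'=d/dz$). *)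

theory Defs
  imports "HOL-Complex_Analysis.Complex_Analysis" "Jordan_Normal_Form.Determinant"
begin

(* The integral of f over the unit circle against the measure d\<zeta> / (2 \<pi> i \<zeta>) = d\<theta> / (2 \<pi>). *)
definition circ_int :: "(complex \<Rightarrow> complex) \<Rightarrow> complex" where
  "circ_int f = contour_integral (circlepath 0 1) (\<lambda>\<zeta>. f \<zeta> / (2 * of_real pi * \<i> * \<zeta>))"

definition circ_L1 :: "(complex \<Rightarrow> complex) \<Rightarrow> bool" where
  "circ_L1 f \<longleftrightarrow> set_integrable lborel {-pi<..pi} (\<lambda>\<theta>. f (cis \<theta>))"

definition weight_coeff :: "(complex \<Rightarrow> complex) \<Rightarrow> int \<Rightarrow> complex" where
  "weight_coeff w k = circ_int (\<lambda>\<zeta>. w \<zeta> * \<zeta> powi (- k))"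

(* The plane with cuts removed; the union of the cuts is only required to be
   closed with empty interior, so any system of branch cuts and isolated
   singularities is covered. *)
definition cut_plane :: "complex set \<Rightarrow> bool" where
  "cut_plane D \<longleftrightarrow> open D \<and> closure D = UNIV"

(* Matrix.mat and Determinant.det are those of Jordan_Normal_Form,
   not the homonyms of HOL-Analysis. *)
definition toeplitz_det :: "(complex \<Rightarrow> complex) \<Rightarrow> nat \<Rightarrow> complex" where
  "toeplitz_det w n =
     Determinant.det (Matrix.mat n n (\<lambda>(j, k). weight_coeff w (int j - int k)))"

definition admissible_weight :: "complex set \<Rightarrow> (complex \<Rightarrow> complex) \<Rightarrow> bool" where
  "admissible_weight D w \<longleftrightarrow>
     cut_plane D \<and> w analytic_on D \<and>
     (\<forall>j::int. circ_L1 (\<lambda>\<zeta>. \<zeta> powi j * w \<zeta>) \<and> circ_L1 (\<lambda>\<zeta>. \<zeta> powi j * deriv w \<zeta>)) \<and>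
     (\<exists>r R. 0 \<le> r \<and> r < 1 \<and> 1 < R \<and>
        (\<forall>z. r < norm z \<and> norm z < R \<longrightarrow>
           ((\<lambda>k::int. weight_coeff w k * z powi k) has_sum w z) UNIV)) \<and>
     (\<forall>n\<ge>1. toeplitz_det w n \<noteq> 0)"

(* \<phi>b stands for the second family of polynomials, written with a bar in the literature;
   it is unrelated to the complex conjugates of the \<phi> n. Its argument is the
   conjugate of \<zeta>, which is 1 / \<zeta> on the unit circle. *)
definition biorthonormal ::
  "(complex \<Rightarrow> complex) \<Rightarrow> (nat \<Rightarrow> complex) \<Rightarrow> (nat \<Rightarrow> complex poly) \<Rightarrow> (nat \<Rightarrow> complex poly) \<Rightarrow> bool"
where
  "biorthonormal w \<kappa> \<phi> \<phi>b \<longleftrightarrow>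
     (\<forall>n. \<kappa> n \<noteq> 0 \<and>
          degree (\<phi> n) = n \<and> lead_coeff (\<phi> n) = \<kappa> n \<and>
          degree (\<phi>b n) = n \<and> lead_coeff (\<phi>b n) = \<kappa> n) \<and>
     (\<forall>m n. circ_int (\<lambda>\<zeta>. w \<zeta> * poly (\<phi> m) \<zeta> * poly (\<phi>b n) (1 / \<zeta>)) = (if m = n then 1 else 0))"

(* As degree (\<phi>b n) = n, this is z ^ n * poly (\<phi>b n) (1 / z) for z \<noteq> 0. *)
definition phi_star :: "(nat \<Rightarrow> complex poly) \<Rightarrow> nat \<Rightarrow> complex poly" where
  "phi_star \<phi>b n = reflect_poly (\<phi>b n)"

definition caratheodory :: "(complex \<Rightarrow> complex) \<Rightarrow> complex \<Rightarrow> complex" where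
  "caratheodory w z = circ_int (\<lambda>\<zeta>. (\<zeta> + z) / (\<zeta> - z) * w \<zeta>)"

(* The associated functions; meaningful only for norm z \<noteq> 1. *)
definition assoc_eps ::
  "(complex \<Rightarrow> complex) \<Rightarrow> (nat \<Rightarrow> complex) \<Rightarrow> (nat \<Rightarrow> complex poly) \<Rightarrow> nat \<Rightarrow> complex \<Rightarrow> complex" where
  "assoc_eps w \<kappa> \<phi> n z =
     (if n = 0 then 1 / \<kappa> 0 + \<kappa> 0 * caratheodory w z
      else circ_int (\<lambda>\<zeta>. (\<zeta> + z) / (\<zeta> - z) * w \<zeta> * poly (\<phi> n) \<zeta>))"

definition assoc_eps_star ::
  "(complex \<Rightarrow> complex) \<Rightarrow> (nat \<Rightarrow> complex) \<Rightarrow> (nat \<Rightarrow> complex poly) \<Rightarrow> nat \<Rightarrow> complex \<Rightarrow> complex" where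
  "assoc_eps_star w \<kappa> \<phi>b n z =
     (if n = 0 then 1 / \<kappa> 0 - \<kappa> 0 * caratheodory w z
      else - (z ^ n) * circ_int (\<lambda>\<zeta>. (\<zeta> + z) / (\<zeta> - z) * w \<zeta> * poly (\<phi>b n) (1 / \<zeta>)))"

(* The relations determine the coefficient functions at every z with z \<noteq> 0 and
   norm z \<noteq> 1, because the Casoratians \<phi>_(n+1) \<epsilon>_n - \<epsilon>_(n+1) \<phi>_n and
   \<phi>*_(n+1) \<epsilon>*_n - \<epsilon>*_(n+1) \<phi>*_n are nonzero multiples of powers of z.
   The coefficient functions may have a pole at 0. *)
definition coefficient_functions ::
  "complex set \<Rightarrow> (complex \<Rightarrow> complex) \<Rightarrow> (nat \<Rightarrow> complex) \<Rightarrow> (nat \<Rightarrow> complex poly) \<Rightarrow> (nat \<Rightarrow> complex poly) \<Rightarrow>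
   (complex \<Rightarrow> complex) \<Rightarrow> (complex \<Rightarrow> complex) \<Rightarrow>
   (nat \<Rightarrow> complex \<Rightarrow> complex) \<Rightarrow> (nat \<Rightarrow> complex \<Rightarrow> complex) \<Rightarrow>
   (nat \<Rightarrow> complex \<Rightarrow> complex) \<Rightarrow> (nat \<Rightarrow> complex \<Rightarrow> complex) \<Rightarrow> bool" where
  "coefficient_functions D w \<kappa> \<phi> \<phi>b W V \<Theta> \<Omega> \<Theta>s \<Omega>s \<longleftrightarrow>
     (\<forall>n. \<forall>z\<in>D. z \<noteq> 0 \<and> norm z \<noteq> 1 \<longrightarrow>
        W z * poly (pderiv (\<phi> n)) z
          = \<Theta> n z * poly (\<phi> (n + 1)) z - (\<Omega> n z + V z) * poly (\<phi> n) z \<and>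
        W z * deriv (assoc_eps w \<kappa> \<phi> n) z
          = \<Theta> n z * assoc_eps w \<kappa> \<phi> (n + 1) z - (\<Omega> n z - V z) * assoc_eps w \<kappa> \<phi> n z \<and>
        W z * poly (pderiv (phi_star \<phi>b n)) z
          = - \<Theta>s n z * poly (phi_star \<phi>b (n + 1)) z + (\<Omega>s n z - V z) * poly (phi_star \<phi>b n) z \<and>
        W z * deriv (assoc_eps_star w \<kappa> \<phi>b n) z
          = - \<Theta>s n z * assoc_eps_star w \<kappa> \<phi>b (n + 1) z + (\<Omega>s n z + V z) * assoc_eps_star w \<kappa> \<phi>b n z)"

end

theory Submission
  imports Defs
begin

text \<open>The pairs \<open>p = (\<phi>\<^sub>n, \<epsilon>\<^sub>n)\<close> and \<open>q = (\<phi>\<^sub>n\<^sup>*, - \<epsilon>\<^sub>n\<^sup>*)\<close> of polynomials and associated functions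
obey one and the same linear recurrence, with coefficients independent of the component,

  \<open>p\<^sub>n\<^sub>+\<^sub>1 = a\<^sub>n z p\<^sub>n + b\<^sub>n q\<^sub>n\<close> and \<open>q\<^sub>n\<^sub>+\<^sub>1 = a\<^sub>n q\<^sub>n + c\<^sub>n z p\<^sub>n\<close> with \<open>a\<^sub>n\<^sup>2 - b\<^sub>n c\<^sub>n = 1\<close>.

For the polynomials these are the Szego recurrences (\<open>szego_recurrence\<close>,
\<open>szego_recurrence_reflected\<close>, \<open>kappa_squared\<close>), which follow from orthogonality and the Toeplitz
structure of the moments. The associated functions inherit them (\<open>assoc_eps_recurrence\<close>,
\<open>assoc_eps_star_recurrence\<close>) because they are Cauchy integrals of the polynomials against the
weight, and such integrals turn multiplication by \<open>\<zeta>\<close> into multiplication by \<open>z\<close> up to constants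
that cancel. Since the recurrence has determinant \<open>z\<close>, the Casoratian of \<open>p\<^sub>n\<close> and \<open>q\<^sub>n\<close> is a
non-zero multiple of \<open>z ^ n\<close> (\<open>casoratian\<close>), so \<open>p\<^sub>n\<close> and \<open>q\<^sub>n\<close> are linearly independent
wherever \<open>z \<noteq> 0\<close>.

The defining relations of \<open>\<Theta>\<close>, \<open>\<Omega>\<close>, \<open>\<Theta>\<^sup>*\<close>, \<open>\<Omega>\<^sup>*\<close> say that the derivation \<open>W d/dz\<close>, corrected by
\<open>V\<close> on the first component and by \<open>- V\<close> on the second, sends \<open>p\<^sub>n\<close> to
\<open>\<Theta>\<^sub>n p\<^sub>n\<^sub>+\<^sub>1 - \<Omega>\<^sub>n p\<^sub>n\<close> and \<open>q\<^sub>n\<close> to \<open>- \<Theta>\<^sub>n\<^sup>* q\<^sub>n\<^sub>+\<^sub>1 + \<Omega>\<^sub>n\<^sup>* q\<^sub>n\<close>. Applying it to the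
recurrence in two ways and comparing coefficients of \<open>p\<^sub>n\<close> and \<open>q\<^sub>n\<close> gives the four relations
that mix starred and unstarred functions. Comparing in the same way for the three-term
recurrences that \<open>p\<close> and \<open>q\<close> satisfy separately gives the two relations with three consecutive
indices. The two remaining relations follow from the mixed ones together with \<open>trace\<close>, which
computes the derivative of the Casoratian by means of Liouville's formula.\<close>

section \<open>Bi-orthogonal polynomials for a Toeplitz pairing\<close>

lemma degree_less_if_coeff_0:
  assumes "degree p \<le> n" and "coeff p n = 0"
  shows "p = 0 \<or> degree p < n"
  using assms by (metis le_neq_implies_less leading_coeff_0_iff)

text \<open>A family with one polynomial in each degree is a graded basis, so a linear functional that kills
its first \<open>n\<close> members kills every polynomial of degree below \<open>n\<close>.\<close>

lemma functional_vanishes_below_degree: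
  fixes L :: "'a::field poly \<Rightarrow> 'a"
  assumes add: "\<And>p q. L (p + q) = L p + L q"
    and smult: "\<And>c p. L (Polynomial.smult c p) = c * L p"
    and deg: "\<And>k. degree (\<psi> k) = k" and nz: "\<And>k. \<psi> k \<noteq> 0"
    and zero: "\<And>k. k < n \<Longrightarrow> L (\<psi> k) = 0"
    and "degree p < n"
  shows "L p = 0"
  using \<open>degree p < n\<close>
proof (induction "degree p" arbitrary: p rule: less_induct)
  case less
  have L0: "L 0 = 0" using smult[of 0 0] by simp
  show ?case
  proof (cases "p = 0")
    case False
    define d where "d = degree p"
    define c where "c = lead_coeff p / lead_coeff (\<psi> d)"
    define q where "q = p - Polynomial.smult c (\<psi> d)"
    have lead: "coeff (\<psi> d) d \<noteq> 0"
      using nz deg by (metis leading_coeff_0_iff)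
    have "degree q \<le> d"
      unfolding q_def using deg by (intro degree_diff_le) (auto simp: d_def)
    moreover have "coeff q d = 0"
      using lead deg[of d] by (simp add: q_def c_def) (simp add: d_def)
    ultimately have "q = 0 \<or> degree q < d" by (rule degree_less_if_coeff_0)
    then have "L q = 0"
      using less L0 unfolding d_def by auto
    moreover have "L p = L q + c * L (\<psi> d)"
      by (metis add smult q_def diff_add_cancel)
    ultimately show ?thesis using zero less.prems by (simp add: d_def)
  qed (simp add: L0)
qed

text \<open>Only two features of the integral matter for the algebra of the polynomials: bilinearity, and the
Toeplitz property \<open>shift\<close>, which reflects that \<open>\<zeta>\<close> and \<open>1 / \<zeta>\<close> cancel on the circle. The axioms
are symmetric in the two families, so every result yields its counterpart through \<open>swapped\<close>.\<close>

locale biorthogonal_polys =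
  fixes B :: "'a::field poly \<Rightarrow> 'a poly \<Rightarrow> 'a"
    and \<kappa> :: "nat \<Rightarrow> 'a" and \<phi> \<phi>b :: "nat \<Rightarrow> 'a poly"
  assumes add_left: "B (p + q) r = B p r + B q r"
    and add_right: "B p (q + r) = B p q + B p r"
    and smult_left: "B (Polynomial.smult c p) q = c * B p q"
    and smult_right: "B p (Polynomial.smult c q) = c * B p q"
    and shift: "B (pCons 0 p) (pCons 0 q) = B p q"
    and \<kappa>_nz: "\<kappa> n \<noteq> 0"
    and degree_\<phi>: "degree (\<phi> n) = n" and lead_\<phi>: "coeff (\<phi> n) n = \<kappa> n"
    and degree_\<phi>b: "degree (\<phi>b n) = n" and lead_\<phi>b: "coeff (\<phi>b n) n = \<kappa> n"
    and biorth: "B (\<phi> m) (\<phi>b n) = (if m = n then 1 else 0)"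
begin

lemma swapped: "biorthogonal_polys (\<lambda>p q. B q p) \<kappa> \<phi>b \<phi>"
  by unfold_locales
    (auto simp: add_left add_right smult_left smult_right shift \<kappa>_nz degree_\<phi> lead_\<phi>
      degree_\<phi>b lead_\<phi>b biorth)

lemma zero_left [simp]: "B 0 q = 0" and zero_right [simp]: "B p 0 = 0"
  using smult_left[of 0 0] smult_right[of _ 0 0] by simp_all

lemma diff_left: "B (p - q) r = B p r - B q r"
  using add_left[of "p - q" q r] by simp

lemma diff_right: "B r (p - q) = B r p - B r q"
  using add_right[of r "p - q" q] by simp

lemma sum_left: "B (sum f A) q = (\<Sum>i\<in>A. B (f i) q)"
  by (induction A rule: infinite_finite_induct) (simp_all add: add_left)

lemma sum_right: "B q (sum f A) = (\<Sum>i\<in>A. B q (f i))"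
  by (induction A rule: infinite_finite_induct) (simp_all add: add_right)

lemma orthogonal_below:
  assumes "degree q < n"
  shows "B (\<phi> n) q = 0"
proof (rule functional_vanishes_below_degree[where L = "B (\<phi> n)" and \<psi> = \<phi>b and n = n])
  show "\<phi>b k \<noteq> 0" for k
    using lead_\<phi>b[of k] \<kappa>_nz[of k] by auto
qed (auto simp: add_right smult_right degree_\<phi>b biorth assms)

lemma pairing_degree_le:
  assumes "degree q \<le> n"
  shows "B (\<phi> n) q = coeff q n / \<kappa> n"
proof -
  define r where "r = q - Polynomial.smult (coeff q n / \<kappa> n) (\<phi>b n)"
  have "degree r \<le> n"
    unfolding r_def using assms degree_\<phi>b by (intro degree_diff_le) auto
  moreover have "coeff r n = 0"
    by (simp add: r_def lead_\<phi>b \<kappa>_nz)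
  ultimately have "r = 0 \<or> degree r < n"
    by (rule degree_less_if_coeff_0)
  then have "B (\<phi> n) r = 0" using orthogonal_below by auto
  then show ?thesis by (simp add: r_def diff_right smult_right biorth)
qed

lemma shift_monom: "B (monom 1 (k + a)) (monom 1 (k + b)) = B (monom 1 a) (monom 1 b)"
  by (induction k) (simp_all add: monom_Suc shift)

text \<open>A Toeplitz matrix is symmetric about its antidiagonal; for polynomials this says that reversing
the coefficients exchanges the two arguments of the pairing.\<close>

lemma toeplitz_monom:
  assumes "i \<le> n" "j \<le> n"
  shows "B (monom 1 i) (monom 1 j) = B (monom 1 (n - j)) (monom 1 (n - i))"
proof (cases "i \<le> j")
  case True
  then show ?thesis
    using shift_monom[of i 0 "j - i"] shift_monom[of "n - j" 0 "j - i"] assms by simp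
next
  case False
  then show ?thesis
    using shift_monom[of j "i - j" 0] shift_monom[of "n - i" "i - j" 0] assms by simp
qed

lemma reflect_pairing:
  assumes j: "j \<le> degree p"
  shows "B (reflect_poly p) (monom 1 j) = B (monom 1 (degree p - j)) p"
proof -
  let ?n = "degree p"
  have p: "p = (\<Sum>i\<le>?n. monom (coeff p i) i)"
    by (rule poly_as_sum_of_monoms[symmetric])
  also have "\<dots> = (\<Sum>i\<le>?n. monom (coeff p (?n - i)) (?n - i))"
    by (rule sum.nat_diff_reindex[of _ "Suc ?n", unfolded lessThan_Suc_atMost, simplified, symmetric])
  finally have p: "p = (\<Sum>i\<le>?n. Polynomial.smult (coeff p (?n - i)) (monom 1 (?n - i)))"
    by (simp add: smult_monom)
  have "reflect_poly p = (\<Sum>i\<le>?n. monom (coeff (reflect_poly p) i) i)"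
    by (rule poly_as_sum_of_monoms'[symmetric]) (rule degree_reflect_poly_le)
  also have "\<dots> = (\<Sum>i\<le>?n. Polynomial.smult (coeff p (?n - i)) (monom 1 i))"
    by (intro sum.cong) (auto simp: coeff_reflect_poly smult_monom)
  finally have r: "reflect_poly p = (\<Sum>i\<le>?n. Polynomial.smult (coeff p (?n - i)) (monom 1 i))" .
  have "B (monom 1 (?n - j)) p
      = B (monom 1 (?n - j)) (\<Sum>i\<le>?n. Polynomial.smult (coeff p (?n - i)) (monom 1 (?n - i)))"
    using p by simp
  also have "\<dots> = B (reflect_poly p) (monom 1 j)"
    unfolding r sum_left sum_right smult_left smult_right
    using j by (intro sum.cong) (auto simp: toeplitz_monom[of _ ?n j])
  finally show ?thesis ..
qed

lemma reflect_pairing_const: "B (reflect_poly (\<phi>b n)) 1 = 1 / \<kappa> n"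
  using reflect_pairing[of 0 "\<phi>b n"]
    biorthogonal_polys.pairing_degree_le[OF swapped, of "monom 1 n" n]
  by (simp add: degree_\<phi>b degree_monom_eq monom_0 flip: one_pCons)

lemma pairing_const: "B (\<phi> n) 1 = (if n = 0 then 1 / \<kappa> 0 else 0)"
  using pairing_degree_le[of 1 n] by simp

text \<open>The difference of the two sides has no constant term and no term of degree \<open>n + 1\<close>, so it is \<open>z\<close>
times a polynomial \<open>s\<close> of degree below \<open>n\<close>. Each of the three terms is orthogonal to
\<open>z, \<dots>, z ^ n\<close>, hence \<open>s\<close> is orthogonal to everything of degree below \<open>n\<close>. Its own leading
coefficient, which can be read off by pairing with the member of the second family of the same
degree, must then vanish.\<close>

theorem szego_recurrence:
  "Polynomial.smult (\<kappa> n) (\<phi> (Suc n))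
     = Polynomial.smult (\<kappa> (Suc n)) (pCons 0 (\<phi> n)) + Polynomial.smult (poly (\<phi> (Suc n)) 0) (reflect_poly (\<phi>b n))"
proof -
  interpret swp: biorthogonal_polys "\<lambda>p q. B q p" \<kappa> \<phi>b \<phi> by (rule swapped)
  define r where "r = Polynomial.smult (\<kappa> n) (\<phi> (Suc n)) - Polynomial.smult (\<kappa> (Suc n)) (pCons 0 (\<phi> n))
     - Polynomial.smult (poly (\<phi> (Suc n)) 0) (reflect_poly (\<phi>b n))"
  have r0: "coeff r 0 = 0"
    by (simp add: r_def lead_\<phi>b degree_\<phi>b poly_0_coeff_0)
  obtain s where s: "r = pCons 0 s"
    using r0 by (metis coeff_pCons_0 pCons_cases)
  have "s = 0"
  proof (rule ccontr)
    assume "s \<noteq> 0"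
    have "degree r \<le> Suc n"
      unfolding r_def
      by (intro degree_diff_le order.trans[OF degree_smult_le])
        (auto simp: degree_\<phi> degree_pCons_eq_if
          intro: order.trans[OF degree_reflect_poly_le] simp: degree_\<phi>b)
    then have "degree s \<le> n"
      using \<open>s \<noteq> 0\<close> by (simp add: s)
    moreover have "coeff r (Suc n) = 0"
      by (simp add: r_def lead_\<phi> coeff_reflect_poly degree_\<phi>b)
    ultimately have deg: "degree s < n"
      using \<open>s \<noteq> 0\<close> degree_less_if_coeff_0[of s n] by (simp add: s)
    \<comment> \<open>shifting back by one turns orthogonality to \<open>z ^ (j + 1)\<close> into orthogonality to \<open>z ^ j\<close>\<close>
    have monom0: "B s (monom 1 j) = 0" if "j < n" for j
    proof -
      have "B s (monom 1 j) = B r (monom 1 (Suc j))"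
        by (simp add: s monom_Suc shift)
      also have "\<dots> = \<kappa> n * B (\<phi> (Suc n)) (monom 1 (Suc j))
          - \<kappa> (Suc n) * B (\<phi> n) (monom 1 j)
          - poly (\<phi> (Suc n)) 0 * B (monom 1 (n - Suc j)) (\<phi>b n)"
        using reflect_pairing[of "Suc j" "\<phi>b n"] that
        by (simp add: r_def diff_left smult_left shift degree_\<phi>b monom_Suc[of _ j])
      also have "\<dots> = 0"
        using that by (simp add: orthogonal_below swp.orthogonal_below degree_monom_eq)
      finally show ?thesis .
    qed
    have "B s (\<phi>b (degree s)) = 0"
      by (rule functional_vanishes_below_degree[where \<psi> = "monom 1" and n = n])
        (use deg in \<open>auto simp: add_right smult_right degree_monom_eq monom0 degree_\<phi>b monom_eq_0_iff\<close>)
    moreover have "B s (\<phi>b (degree s)) = lead_coeff s / \<kappa> (degree s)"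
      by (rule swp.pairing_degree_le) simp
    ultimately show False
      using \<open>s \<noteq> 0\<close> \<kappa>_nz by simp
  qed
  then show ?thesis using s by (simp add: r_def algebra_simps)
qed

text \<open>This is the recurrence of the second family with the coefficients read backwards.\<close>

theorem szego_recurrence_reflected:
  "Polynomial.smult (\<kappa> n) (reflect_poly (\<phi>b (Suc n)))
     = Polynomial.smult (\<kappa> (Suc n)) (reflect_poly (\<phi>b n)) + Polynomial.smult (poly (\<phi>b (Suc n)) 0) (pCons 0 (\<phi> n))"
proof (rule poly_eqI)
  fix i
  interpret swp: biorthogonal_polys "\<lambda>p q. B q p" \<kappa> \<phi>b \<phi> by (rule swapped)
  have "coeff (Polynomial.smult (\<kappa> n) (\<phi>b (Suc n))) (Suc n - i)
      = coeff (Polynomial.smult (\<kappa> (Suc n)) (pCons 0 (\<phi>b n)) + Polynomial.smult (poly (\<phi>b (Suc n)) 0) (reflect_poly (\<phi> n))) (Suc n - i)"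
    using swp.szego_recurrence[of n] by simp
  then show "coeff (Polynomial.smult (\<kappa> n) (reflect_poly (\<phi>b (Suc n)))) i
     = coeff (Polynomial.smult (\<kappa> (Suc n)) (reflect_poly (\<phi>b n)) + Polynomial.smult (poly (\<phi>b (Suc n)) 0) (pCons 0 (\<phi> n))) i"
    by (auto simp: coeff_reflect_poly degree_\<phi> degree_\<phi>b coeff_pCons coeff_eq_0 Suc_diff_le
        split: nat.splits)
qed

text \<open>Orthogonality does not determine the mean of \<open>z \<phi>\<^sub>n\<close>, but pairing the two recurrences with
the constant \<open>1\<close> gives two equations for it. They cancel the inhomogeneous terms in the recurrences
of the associated functions, and eliminating the mean relates consecutive values of \<open>\<kappa>\<close>.\<close>

lemma shift_pairing_const:
  "\<kappa> (Suc n) * B (pCons 0 (\<phi> n)) 1 + poly (\<phi> (Suc n)) 0 / \<kappa> n = 0"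
proof -
  have "0 = B (Polynomial.smult (\<kappa> n) (\<phi> (Suc n))) 1"
    by (simp add: smult_left pairing_const)
  then show ?thesis
    by (simp add: szego_recurrence add_left smult_left reflect_pairing_const del: smult_pCons)
qed

lemma kappa_ratio_shift_pairing:
  "\<kappa> n / \<kappa> (Suc n)
     = \<kappa> (Suc n) / \<kappa> n + poly (\<phi>b (Suc n)) 0 * B (pCons 0 (\<phi> n)) 1"
proof -
  have "\<kappa> n / \<kappa> (Suc n) = B (Polynomial.smult (\<kappa> n) (reflect_poly (\<phi>b (Suc n)))) 1"
    by (simp add: smult_left reflect_pairing_const)
  then show ?thesis
    by (simp add: szego_recurrence_reflected add_left smult_left reflect_pairing_const
        del: smult_pCons)
qed

theorem kappa_squared:
  "\<kappa> (Suc n) ^ 2 - poly (\<phi> (Suc n)) 0 * poly (\<phi>b (Suc n)) 0 = \<kappa> n ^ 2"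
proof -
  define m where "m = B (pCons 0 (\<phi> n)) 1"
  have 1: "\<kappa> n * \<kappa> (Suc n) * m = - poly (\<phi> (Suc n)) 0"
    using shift_pairing_const[of n] \<kappa>_nz[of n]
    by (simp add: m_def field_simps eq_neg_iff_add_eq_0)
  have "\<kappa> n ^ 2 = \<kappa> (Suc n) ^ 2 + poly (\<phi>b (Suc n)) 0 * (\<kappa> n * \<kappa> (Suc n) * m)"
    using kappa_ratio_shift_pairing[of n] \<kappa>_nz[of n] \<kappa>_nz[of "Suc n"]
    by (simp add: m_def field_simps power2_eq_square)
  then show ?thesis unfolding 1 by (simp add: algebra_simps)
qed

end

section \<open>Means over the circle and their Cauchy kernels\<close>

text \<open>Convergence at \<open>z = 1\<close> is absolute, and all terms have the same modulus on the whole circle, so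
the series converges uniformly there.\<close>

lemma continuous_on_circle_Laurent:
  assumes "\<And>z. norm z = 1 \<Longrightarrow> ((\<lambda>k::int. c k * z powi k) has_sum f z) UNIV"
  shows "continuous_on (sphere 0 1) (f :: complex \<Rightarrow> complex)"
proof (rule uniform_limit_theorem)
  have "c summable_on UNIV"
    using assms[of 1] by (auto simp: summable_on_def)
  then have sum: "(\<lambda>k. norm (c k)) summable_on UNIV"
    by (simp add: summable_on_iff_abs_summable_on_complex)
  show "uniform_limit (sphere 0 1) (\<lambda>K z. \<Sum>k\<in>K. c k * z powi k) f (finite_subsets_at_top UNIV)"
    by (rule Weierstrass_m_test_general'[OF _ _ sum])
      (use assms in \<open>auto simp: norm_mult norm_power_int\<close>)
qed (auto intro!: always_eventually continuous_intros)

text \<open>The Cauchy integral of \<open>f\<close> over the circle, since the kernel is \<open>d\<zeta> / (2 \<pi> \<i> (\<zeta> - z))\<close> when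
the factor \<open>1 / \<zeta>\<close> of the measure is absorbed.\<close>

definition cauchy_mean :: "(complex \<Rightarrow> complex) \<Rightarrow> complex \<Rightarrow> complex" where
  "cauchy_mean f z = circ_int (\<lambda>\<zeta>. \<zeta> / (\<zeta> - z) * f \<zeta>)"

abbreviation circ_cont :: "(complex \<Rightarrow> complex) \<Rightarrow> bool" where
  "circ_cont f \<equiv> continuous_on (sphere 0 1) f"

lemma circ_integrable:
  assumes "circ_cont f"
  shows "(\<lambda>\<zeta>. f \<zeta> / (2 * of_real pi * \<i> * \<zeta>)) contour_integrable_on circlepath 0 1"
  using assms
  by (intro contour_integrable_continuous_circlepath) (auto intro!: continuous_intros)

lemma circ_int_add:
  assumes "circ_cont f" "circ_cont g"
  shows "circ_int (\<lambda>\<zeta>. f \<zeta> + g \<zeta>) = circ_int f + circ_int g"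
  unfolding circ_int_def add_divide_distrib
  by (intro contour_integral_add circ_integrable assms)

lemma circ_int_cmult:
  assumes "circ_cont f"
  shows "circ_int (\<lambda>\<zeta>. c * f \<zeta>) = c * circ_int f"
  unfolding circ_int_def times_divide_eq_right[symmetric]
  by (intro contour_integral_lmul circ_integrable assms)

lemma circ_int_diff:
  assumes "circ_cont f" "circ_cont g"
  shows "circ_int (\<lambda>\<zeta>. f \<zeta> - g \<zeta>) = circ_int f - circ_int g"
  unfolding circ_int_def diff_divide_distrib
  by (intro contour_integral_diff circ_integrable assms)

lemma circ_int_cong:
  assumes "\<And>\<zeta>. norm \<zeta> = 1 \<Longrightarrow> f \<zeta> = g \<zeta>"
  shows "circ_int f = circ_int g"
  unfolding circ_int_def by (rule contour_integral_eq) (simp add: assms)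

lemma circ_cont_kernel:
  assumes "circ_cont f" and "norm z \<noteq> 1"
  shows "circ_cont (\<lambda>\<zeta>. \<zeta> / (\<zeta> - z) * f \<zeta>)"
  using assms by (auto intro!: continuous_intros)

lemma cauchy_mean_add:
  assumes "circ_cont f" "circ_cont g" "norm z \<noteq> 1"
  shows "cauchy_mean (\<lambda>\<zeta>. f \<zeta> + g \<zeta>) z = cauchy_mean f z + cauchy_mean g z"
  unfolding cauchy_mean_def distrib_left
  by (intro circ_int_add circ_cont_kernel assms)

lemma cauchy_mean_cmult:
  assumes "circ_cont f" "norm z \<noteq> 1"
  shows "cauchy_mean (\<lambda>\<zeta>. c * f \<zeta>) z = c * cauchy_mean f z"
  unfolding cauchy_mean_def mult.left_commute[of _ c]
  by (intro circ_int_cmult circ_cont_kernel assms)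

text \<open>Multiplication by \<open>\<zeta>\<close> becomes multiplication by \<open>z\<close> up to a constant, because
\<open>\<zeta> / (\<zeta> - z) = z / (\<zeta> - z) + 1\<close>.\<close>

lemma cauchy_mean_shift:
  assumes "circ_cont f" "norm z \<noteq> 1"
  shows "cauchy_mean (\<lambda>\<zeta>. \<zeta> * f \<zeta>) z = z * cauchy_mean f z + circ_int (\<lambda>\<zeta>. \<zeta> * f \<zeta>)"
proof -
  have "cauchy_mean (\<lambda>\<zeta>. \<zeta> * f \<zeta>) z = circ_int (\<lambda>\<zeta>. z * (\<zeta> / (\<zeta> - z) * f \<zeta>) + \<zeta> * f \<zeta>)"
    unfolding cauchy_mean_def
  proof (rule circ_int_cong)
    fix \<zeta> :: complex assume "norm \<zeta> = 1"
    then have "\<zeta> - z \<noteq> 0" using assms by auto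
    then show "\<zeta> / (\<zeta> - z) * (\<zeta> * f \<zeta>) = z * (\<zeta> / (\<zeta> - z) * f \<zeta>) + \<zeta> * f \<zeta>"
      by (simp add: divide_simps) (simp add: algebra_simps)
  qed
  also have "\<dots> = z * cauchy_mean f z + circ_int (\<lambda>\<zeta>. \<zeta> * f \<zeta>)"
    unfolding cauchy_mean_def
    by (subst circ_int_add circ_int_cmult; (intro circ_cont_kernel continuous_intros assms)?)+ simp
  finally show ?thesis .
qed

lemma herglotz_kernel_integral:
  assumes "circ_cont f" "norm z \<noteq> 1"
  shows "circ_int (\<lambda>\<zeta>. (\<zeta> + z) / (\<zeta> - z) * f \<zeta>) = 2 * cauchy_mean f z - circ_int f"
proof -
  have "circ_int (\<lambda>\<zeta>. (\<zeta> + z) / (\<zeta> - z) * f \<zeta>) = circ_int (\<lambda>\<zeta>. 2 * (\<zeta> / (\<zeta> - z) * f \<zeta>) - f \<zeta>)"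
  proof (rule circ_int_cong)
    fix \<zeta> :: complex assume "norm \<zeta> = 1"
    then have "\<zeta> - z \<noteq> 0" using assms by auto
    then show "(\<zeta> + z) / (\<zeta> - z) * f \<zeta> = 2 * (\<zeta> / (\<zeta> - z) * f \<zeta>) - f \<zeta>"
      by (simp add: divide_simps) (simp add: algebra_simps)
  qed
  also have "\<dots> = 2 * cauchy_mean f z - circ_int f"
    unfolding cauchy_mean_def
    by (subst circ_int_diff circ_int_cmult; (intro circ_cont_kernel continuous_intros assms)?)+ simp
  finally show ?thesis .
qed

lemma cauchy_mean_differentiable:
  assumes f: "circ_cont f" and z: "norm z \<noteq> 1"
  shows "cauchy_mean f field_differentiable (at z)"
proof -
  let ?g = "\<lambda>\<zeta>. f \<zeta> / (2 * of_real pi * \<i>)"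
  have cont: "continuous_on (path_image (circlepath 0 1)) ?g"
    using f by (auto intro!: continuous_intros)
  have int: "((\<lambda>\<zeta>. ?g \<zeta> / (\<zeta> - u) ^ 1) has_contour_integral cauchy_mean f u) (circlepath 0 1)"
    if "u \<in> UNIV - path_image (circlepath 0 1)" for u
  proof -
    have "norm u \<noteq> 1" using that by auto
    then have "(\<lambda>\<zeta>. \<zeta> / (\<zeta> - u) * f \<zeta> / (2 * of_real pi * \<i> * \<zeta>)) contour_integrable_on circlepath 0 1"
      by (intro circ_integrable circ_cont_kernel f)
    then have "((\<lambda>\<zeta>. \<zeta> / (\<zeta> - u) * f \<zeta> / (2 * of_real pi * \<i> * \<zeta>))
        has_contour_integral cauchy_mean f u) (circlepath 0 1)"
      unfolding cauchy_mean_def circ_int_def by (rule has_contour_integral_integral)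
    then show ?thesis
      by (rule has_contour_integral_eq) (auto simp: divide_simps)
  qed
  have "norm (vector_derivative (circlepath 0 1) (at t)) \<le> 2 * pi" for t
    by (simp add: vector_derivative_circlepath norm_mult)
  then show ?thesis
    using Cauchy_next_derivative(2)[OF cont _ int, where B = "2 * pi" and w = z] z
    by (auto simp: field_differentiable_def)
qed

section \<open>Recurrences and Casoratian of the associated functions\<close>

locale circle_biorthogonal =
  fixes w :: "complex \<Rightarrow> complex" and \<kappa> :: "nat \<Rightarrow> complex" and \<phi> \<phi>b :: "nat \<Rightarrow> complex poly"
  assumes w_cont: "circ_cont w" and biorthonormal: "biorthonormal w \<kappa> \<phi> \<phi>b"
begin

definition pairing :: "complex poly \<Rightarrow> complex poly \<Rightarrow> complex" where
  "pairing p q = circ_int (\<lambda>\<zeta>. w \<zeta> * poly p \<zeta> * poly q (1 / \<zeta>))"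

lemma circ_cont_pairing: "circ_cont (\<lambda>\<zeta>. w \<zeta> * poly p \<zeta> * poly q (1 / \<zeta>))"
  using w_cont by (intro continuous_intros) auto

sublocale biorthogonal_polys pairing \<kappa> \<phi> \<phi>b
proof
  fix p q r :: "complex poly" and c :: complex and m n :: nat
  show "pairing (p + q) r = pairing p r + pairing q r"
    unfolding pairing_def poly_add distrib_left distrib_right
    by (intro circ_int_add circ_cont_pairing)
  show "pairing p (q + r) = pairing p q + pairing p r"
    unfolding pairing_def poly_add distrib_left
    by (intro circ_int_add circ_cont_pairing)
  show "pairing (Polynomial.smult c p) q = c * pairing p q"
    unfolding pairing_def
    by (subst circ_int_cmult[symmetric, OF circ_cont_pairing]) (simp add: mult_ac)
  show "pairing p (Polynomial.smult c q) = c * pairing p q"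
    unfolding pairing_def
    by (subst circ_int_cmult[symmetric, OF circ_cont_pairing]) (simp add: mult_ac)
  show "pairing (pCons 0 p) (pCons 0 q) = pairing p q"
    unfolding pairing_def by (rule circ_int_cong) auto
  show "pairing (\<phi> m) (\<phi>b n) = (if m = n then 1 else 0)"
    using biorthonormal unfolding biorthonormal_def pairing_def by blast
qed (use biorthonormal in \<open>auto simp: biorthonormal_def, metis+\<close>)

lemma circ_cont_poly: "circ_cont (\<lambda>\<zeta>. w \<zeta> * poly p \<zeta>)"
  using w_cont by (intro continuous_intros) auto

abbreviation transform :: "complex poly \<Rightarrow> complex \<Rightarrow> complex" where
  "transform p \<equiv> cauchy_mean (\<lambda>\<zeta>. w \<zeta> * poly p \<zeta>)"

lemma transform_add:
  "norm z \<noteq> 1 \<Longrightarrow> transform (p + q) z = transform p z + transform q z"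
  by (simp add: distrib_left cauchy_mean_add circ_cont_poly)

lemma transform_smult:
  "norm z \<noteq> 1 \<Longrightarrow> transform (Polynomial.smult c p) z = c * transform p z"
  by (simp add: mult.left_commute[of _ c] cauchy_mean_cmult circ_cont_poly)

lemma transform_shift:
  "norm z \<noteq> 1 \<Longrightarrow> transform (pCons 0 p) z = z * transform p z + pairing (pCons 0 p) 1"
  using cauchy_mean_shift[OF circ_cont_poly, of z p]
  by (simp add: pairing_def mult_ac)

lemma \<phi>_0: "\<phi> 0 = [:\<kappa> 0:]" and \<phi>b_0: "\<phi>b 0 = [:\<kappa> 0:]"
  using degree_\<phi>[of 0] degree_\<phi>b[of 0] lead_\<phi>[of 0] lead_\<phi>b[of 0]
  by (metis coeff_pCons_0 degree_eq_zeroE)+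

text \<open>The Herglotz kernel differs from twice the Cauchy kernel by a constant, which only contributes
the mean of \<open>w \<phi>\<^sub>n\<close>. That mean vanishes for \<open>n \<noteq> 0\<close> and is \<open>1 / \<kappa>\<^sub>0\<close> for \<open>n = 0\<close>; the extra
summand in the definition at \<open>n = 0\<close> is exactly the one that makes a single formula hold for all
\<open>n\<close>. The same happens for the second family in \<open>assoc_eps_star_eq\<close>.\<close>

lemma assoc_eps_eq:
  assumes z: "norm z \<noteq> 1"
  shows "assoc_eps w \<kappa> \<phi> n z = 2 * transform (\<phi> n) z"
proof (cases "n = 0")
  case True
  have "\<kappa> 0 * circ_int w = 1 / \<kappa> 0"
    using pairing_const[of 0] circ_int_cmult[OF w_cont, of "\<kappa> 0"]
    by (simp add: pairing_def \<phi>_0 mult.commute)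
  moreover have "transform (\<phi> 0) z = \<kappa> 0 * cauchy_mean w z"
    using cauchy_mean_cmult[OF w_cont z, of "\<kappa> 0"] by (simp add: \<phi>_0 mult.commute)
  moreover have "caratheodory w z = 2 * cauchy_mean w z - circ_int w"
    using herglotz_kernel_integral[OF w_cont z] by (simp add: caratheodory_def)
  ultimately show ?thesis
    using True by (simp add: assoc_eps_def right_diff_distrib)
next
  case False
  then show ?thesis
    using herglotz_kernel_integral[OF circ_cont_poly z, of "\<phi> n"] pairing_const[of n]
    by (simp add: assoc_eps_def pairing_def mult.assoc)
qed

text \<open>On the circle the reflected polynomial is \<open>\<zeta> ^ n\<close> times \<open>\<phi>b n\<close> at \<open>1 / \<zeta>\<close>. Replacing \<open>\<zeta> ^ n\<close>
by \<open>z ^ n\<close> under the Cauchy kernel changes the integrand by a monic polynomial \<open>P\<close> of degree \<open>n\<close>,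
of which orthogonality sees the leading term only.\<close>

lemma transform_reflect:
  assumes z: "norm z \<noteq> 1" and n: "n \<noteq> 0"
  shows "transform (reflect_poly (\<phi>b n)) z
    = z ^ n * cauchy_mean (\<lambda>\<zeta>. w \<zeta> * poly (\<phi>b n) (1 / \<zeta>)) z + 1 / \<kappa> n"
proof -
  interpret swp: biorthogonal_polys "\<lambda>p q. pairing q p" \<kappa> \<phi>b \<phi> by (rule swapped)
  define P where "P = pCons 0 (\<Sum>i<n. monom (z ^ (n - Suc i)) i)"
  have degP: "degree P \<le> n"
    unfolding P_def using n
    by (intro degree_le) (auto simp: coeff_pCons coeff_sum split: nat.splits)
  have coeffP: "coeff P n = 1"
    using n by (cases n) (simp_all add: P_def coeff_sum)
  have cont: "circ_cont (\<lambda>\<zeta>. w \<zeta> * poly (\<phi>b n) (1 / \<zeta>))"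
    using circ_cont_pairing[of 1 "\<phi>b n"] by simp
  have "transform (reflect_poly (\<phi>b n)) z
      = circ_int (\<lambda>\<zeta>. z ^ n * (\<zeta> / (\<zeta> - z) * (w \<zeta> * poly (\<phi>b n) (1 / \<zeta>)))
          + w \<zeta> * poly P \<zeta> * poly (\<phi>b n) (1 / \<zeta>))"
    unfolding cauchy_mean_def
  proof (rule circ_int_cong)
    fix \<zeta> :: complex assume \<zeta>: "norm \<zeta> = 1"
    then have nz: "\<zeta> \<noteq> 0" "\<zeta> - z \<noteq> 0" using z by auto
    have "\<zeta> ^ n - z ^ n = (\<zeta> - z) * (\<Sum>i<n. z ^ (n - Suc i) * \<zeta> ^ i)"
      by (rule power_diff_sumr2)
    then have P: "poly P \<zeta> = \<zeta> / (\<zeta> - z) * (\<zeta> ^ n - z ^ n)"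
      using nz by (simp add: P_def poly_sum poly_monom)
    have "poly (reflect_poly (\<phi>b n)) \<zeta> = \<zeta> ^ n * poly (\<phi>b n) (1 / \<zeta>)"
      using nz by (simp add: poly_reflect_poly_nz degree_\<phi>b inverse_eq_divide)
    then show "\<zeta> / (\<zeta> - z) * (w \<zeta> * poly (reflect_poly (\<phi>b n)) \<zeta>)
        = z ^ n * (\<zeta> / (\<zeta> - z) * (w \<zeta> * poly (\<phi>b n) (1 / \<zeta>)))
          + w \<zeta> * poly P \<zeta> * poly (\<phi>b n) (1 / \<zeta>)"
      unfolding P by (simp add: algebra_simps)
  qed
  also have "\<dots> = z ^ n * cauchy_mean (\<lambda>\<zeta>. w \<zeta> * poly (\<phi>b n) (1 / \<zeta>)) z + pairing P (\<phi>b n)"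
    unfolding cauchy_mean_def pairing_def
    by (subst circ_int_add circ_int_cmult;
        (intro circ_cont_kernel circ_cont_pairing continuous_on_mult_left cont z)?)+ simp
  finally show ?thesis
    using swp.pairing_degree_le[OF degP] coeffP by simp
qed

lemma assoc_eps_star_eq:
  assumes z: "norm z \<noteq> 1"
  shows "assoc_eps_star w \<kappa> \<phi>b n z = 2 / \<kappa> n - 2 * transform (reflect_poly (\<phi>b n)) z"
proof (cases "n = 0")
  case True
  have eps: "2 * transform (reflect_poly (\<phi>b 0)) z = assoc_eps w \<kappa> \<phi> 0 z"
    by (simp add: assoc_eps_eq z \<phi>_0 \<phi>b_0)
  then show ?thesis
    using True by (simp add: eps) (simp add: assoc_eps_def assoc_eps_star_def)
next
  case False
  have cont: "circ_cont (\<lambda>\<zeta>. w \<zeta> * poly (\<phi>b n) (1 / \<zeta>))"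
    using circ_cont_pairing[of 1 "\<phi>b n"] by simp
  have "circ_int (\<lambda>\<zeta>. w \<zeta> * poly (\<phi>b n) (1 / \<zeta>)) = 0"
    using biorthogonal_polys.pairing_const[OF swapped, of n] False by (simp add: pairing_def)
  then show ?thesis
    using False herglotz_kernel_integral[OF cont z]
    by (simp add: assoc_eps_star_def transform_reflect z mult.assoc)
qed

lemma assoc_eps_recurrence:
  assumes z: "norm z \<noteq> 1"
  shows "\<kappa> n * assoc_eps w \<kappa> \<phi> (Suc n) z
    = \<kappa> (Suc n) * z * assoc_eps w \<kappa> \<phi> n z - poly (\<phi> (Suc n)) 0 * assoc_eps_star w \<kappa> \<phi>b n z"
proof -
  have "\<kappa> n * transform (\<phi> (Suc n)) z = transform (Polynomial.smult (\<kappa> n) (\<phi> (Suc n))) z"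
    by (simp only: transform_smult[OF z])
  also have "\<dots> = \<kappa> (Suc n) * (z * transform (\<phi> n) z + pairing (pCons 0 (\<phi> n)) 1)
      + poly (\<phi> (Suc n)) 0 * transform (reflect_poly (\<phi>b n)) z"
    unfolding szego_recurrence by (simp only: transform_add[OF z] transform_smult[OF z] transform_shift[OF z])
  finally have rec: "\<kappa> n * transform (\<phi> (Suc n)) z
    = \<kappa> (Suc n) * (z * transform (\<phi> n) z + pairing (pCons 0 (\<phi> n)) 1)
      + poly (\<phi> (Suc n)) 0 * transform (reflect_poly (\<phi>b n)) z" .
  have "\<kappa> n * assoc_eps w \<kappa> \<phi> (Suc n) z = 2 * (\<kappa> n * transform (\<phi> (Suc n)) z)"
    by (simp add: assoc_eps_eq z)
  also have "\<dots> = \<kappa> (Suc n) * z * assoc_eps w \<kappa> \<phi> n z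
      - poly (\<phi> (Suc n)) 0 * assoc_eps_star w \<kappa> \<phi>b n z
      + 2 * (\<kappa> (Suc n) * pairing (pCons 0 (\<phi> n)) 1 + poly (\<phi> (Suc n)) 0 / \<kappa> n)"
    unfolding rec assoc_eps_eq[OF z] assoc_eps_star_eq[OF z] by (simp add: algebra_simps)
  finally show ?thesis
    by (simp add: shift_pairing_const)
qed

lemma assoc_eps_star_recurrence:
  assumes z: "norm z \<noteq> 1"
  shows "\<kappa> n * assoc_eps_star w \<kappa> \<phi>b (Suc n) z
    = \<kappa> (Suc n) * assoc_eps_star w \<kappa> \<phi>b n z - poly (\<phi>b (Suc n)) 0 * z * assoc_eps w \<kappa> \<phi> n z"
proof -
  have "\<kappa> n * transform (reflect_poly (\<phi>b (Suc n))) z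
      = transform (Polynomial.smult (\<kappa> n) (reflect_poly (\<phi>b (Suc n)))) z"
    by (simp only: transform_smult[OF z])
  also have "\<dots> = \<kappa> (Suc n) * transform (reflect_poly (\<phi>b n)) z
      + poly (\<phi>b (Suc n)) 0 * (z * transform (\<phi> n) z + pairing (pCons 0 (\<phi> n)) 1)"
    unfolding szego_recurrence_reflected
    by (simp only: transform_add[OF z] transform_smult[OF z] transform_shift[OF z])
  finally have rec: "\<kappa> n * transform (reflect_poly (\<phi>b (Suc n))) z
    = \<kappa> (Suc n) * transform (reflect_poly (\<phi>b n)) z
      + poly (\<phi>b (Suc n)) 0 * (z * transform (\<phi> n) z + pairing (pCons 0 (\<phi> n)) 1)" .
  have "\<kappa> n * assoc_eps_star w \<kappa> \<phi>b (Suc n) z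
      = 2 * (\<kappa> n / \<kappa> (Suc n)) - 2 * (\<kappa> n * transform (reflect_poly (\<phi>b (Suc n))) z)"
    by (simp add: assoc_eps_star_eq z right_diff_distrib)
  also have "\<dots> = \<kappa> (Suc n) * assoc_eps_star w \<kappa> \<phi>b n z
      - poly (\<phi>b (Suc n)) 0 * z * assoc_eps w \<kappa> \<phi> n z"
    unfolding rec kappa_ratio_shift_pairing assoc_eps_eq[OF z] assoc_eps_star_eq[OF z]
    by (simp add: algebra_simps)
  finally show ?thesis .
qed

text \<open>The step from \<open>n\<close> to \<open>n + 1\<close> is a linear map of determinant \<open>z\<close> on the pairs
\<open>(\<phi>\<^sub>n, \<phi>\<^sub>n\<^sup>*)\<close> and \<open>(\<epsilon>\<^sub>n, - \<epsilon>\<^sub>n\<^sup>*)\<close>, so their Casoratian grows by the factor \<open>z\<close>.\<close>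

lemma casoratian:
  assumes z: "norm z \<noteq> 1"
  shows "poly (\<phi> n) z * assoc_eps_star w \<kappa> \<phi>b n z
    + assoc_eps w \<kappa> \<phi> n z * poly (reflect_poly (\<phi>b n)) z = 2 * z ^ n"
proof (induction n)
  case 0
  then show ?case
    using \<kappa>_nz[of 0] by (simp add: assoc_eps_def assoc_eps_star_def \<phi>_0 \<phi>b_0 field_simps)
next
  case (Suc n)
  let ?x = "poly (\<phi> n) z" and ?u = "poly (reflect_poly (\<phi>b n)) z"
  let ?y = "assoc_eps w \<kappa> \<phi> n z" and ?v = "assoc_eps_star w \<kappa> \<phi>b n z"
  let ?f = "poly (\<phi> (Suc n)) 0" and ?g = "poly (\<phi>b (Suc n)) 0"
  have x: "\<kappa> n * poly (\<phi> (Suc n)) z = \<kappa> (Suc n) * z * ?x + ?f * ?u"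
    using arg_cong[OF szego_recurrence[of n], of "\<lambda>p. poly p z"] by simp
  have u: "\<kappa> n * poly (reflect_poly (\<phi>b (Suc n))) z = \<kappa> (Suc n) * ?u + ?g * z * ?x"
    using arg_cong[OF szego_recurrence_reflected[of n], of "\<lambda>p. poly p z"] by simp
  let ?X = "poly (\<phi> (Suc n)) z" and ?U = "poly (reflect_poly (\<phi>b (Suc n))) z"
  let ?Y = "assoc_eps w \<kappa> \<phi> (Suc n) z" and ?V = "assoc_eps_star w \<kappa> \<phi>b (Suc n) z"
  have "\<kappa> n ^ 2 * (?X * ?V + ?Y * ?U)
      = (\<kappa> n * ?X) * (\<kappa> n * ?V) + (\<kappa> n * ?Y) * (\<kappa> n * ?U)"
    by (simp add: power2_eq_square algebra_simps)
  also have "\<dots> = (\<kappa> (Suc n) ^ 2 - ?f * ?g) * z * (?x * ?v + ?y * ?u)"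
    unfolding x u assoc_eps_recurrence[OF z] assoc_eps_star_recurrence[OF z]
    by (simp add: power2_eq_square algebra_simps)
  also have "\<dots> = \<kappa> n ^ 2 * (2 * z ^ Suc n)"
    unfolding kappa_squared Suc.IH by simp
  finally show ?case using \<kappa>_nz[of n] by simp
qed

lemma open_off_circle: "open {z::complex. norm z \<noteq> 1}"
  by (intro open_Collect_neq continuous_intros)

lemma has_derivative_off_circle:
  assumes eq: "\<And>z. norm z \<noteq> 1 \<Longrightarrow> f z = c + d * transform p z" and z: "norm z \<noteq> 1"
  shows "(f has_field_derivative deriv f z) (at z)"
proof -
  have "(\<lambda>z. c + d * transform p z) field_differentiable (at z)"
    by (intro derivative_intros cauchy_mean_differentiable circ_cont_poly z)
  then obtain D where "((\<lambda>z. c + d * transform p z) has_field_derivative D) (at z)"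
    by (auto simp: field_differentiable_def)
  then have "(f has_field_derivative D) (at z)"
    by (rule has_field_derivative_transform_within_open[OF _ open_off_circle])
      (use z eq in auto)
  then show ?thesis
    by (metis DERIV_imp_deriv)
qed

lemma assoc_eps_has_derivative:
  "norm z \<noteq> 1 \<Longrightarrow> (assoc_eps w \<kappa> \<phi> n has_field_derivative deriv (assoc_eps w \<kappa> \<phi> n) z) (at z)"
  by (rule has_derivative_off_circle[where c = 0 and d = 2]) (simp_all add: assoc_eps_eq)

lemma assoc_eps_star_has_derivative:
  "norm z \<noteq> 1 \<Longrightarrow>
    (assoc_eps_star w \<kappa> \<phi>b n has_field_derivative deriv (assoc_eps_star w \<kappa> \<phi>b n) z) (at z)"
  by (rule has_derivative_off_circle[where c = "2 / \<kappa> n" and d = "-2"])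
    (simp_all add: assoc_eps_star_eq)

end

section \<open>Compatibility of the recurrences with the differential relations\<close>

text \<open>The values at a fixed point \<open>z\<close> of one solution \<open>(x, u)\<close> of the recurrences, with formal
derivatives \<open>dx\<close> and \<open>du\<close>. The polynomials satisfy the differential relations with \<open>V\<close>, the
associated functions with \<open>- V\<close>. All consequences below are free of \<open>V\<close>, which acts on
each solution as a scalar.\<close>

locale szego_solution =
  fixes a b c :: "nat \<Rightarrow> 'a::field" and z W V :: 'a
    and \<Theta> \<Omega> \<Theta>s \<Omega>s :: "nat \<Rightarrow> 'a"
    and x u dx du :: "nat \<Rightarrow> 'a"
  assumes nz: "z \<noteq> 0" "a n \<noteq> 0" "b n \<noteq> 0" "c n \<noteq> 0"
    and unimodular: "a n ^ 2 - b n * c n = 1"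
    and x_Suc: "x (Suc n) = a n * z * x n + b n * u n"
    and u_Suc: "u (Suc n) = a n * u n + c n * z * x n"
    and dx_Suc: "dx (Suc n) = a n * x n + a n * z * dx n + b n * du n"
    and du_Suc: "du (Suc n) = a n * du n + c n * x n + c n * z * dx n"
    and W_dx: "W * dx n = \<Theta> n * x (Suc n) - (\<Omega> n + V) * x n"
    and W_du: "W * du n = - \<Theta>s n * u (Suc n) + (\<Omega>s n - V) * u n"
begin

text \<open>The relation for \<open>dx (Suc n)\<close> can be expanded in \<open>x n\<close> and \<open>u n\<close> either directly or after
differentiating the recurrence. The two expansions differ by multiples of \<open>x n\<close> and \<open>u n\<close>;
\<open>compat_xx\<close> and \<open>compat_xu\<close> are their normalised coefficients. Likewise \<open>compat_ux\<close> and
\<open>compat_uu\<close> come from \<open>du (Suc n)\<close>.\<close>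

definition "compat_xu n = \<Omega> (Suc n) + \<Omega>s n - (b (Suc n) * a n / b n + a (Suc n) * z) * \<Theta> (Suc n)
  + a n * (z * \<Theta> n - \<Theta>s n)"

definition "compat_xx n = \<Omega> n - \<Omega> (Suc n) + (a (Suc n) * z + b (Suc n) * c n / a n) * \<Theta> (Suc n)
  + b n * c n / a n * \<Theta>s n - a n * z * \<Theta> n - W / z"

definition "compat_ux n = \<Omega>s (Suc n) + \<Omega> n - (a (Suc n) + c (Suc n) * a n / c n * z) * \<Theta>s (Suc n)
  - a n * (z * \<Theta> n - \<Theta>s n) - W / z"

definition "compat_uu n = \<Omega>s n - \<Omega>s (Suc n) + (a (Suc n) + c (Suc n) * b n / a n * z) * \<Theta>s (Suc n)
  + b n * c n / a n * z * \<Theta> n - a n * \<Theta>s n"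

lemma x_compat: "- (a n * z) * compat_xx n * x n + b n * compat_xu n * u n = 0"
proof -
  have compat_xx: "a n * z * compat_xx n = a n * z * (\<Omega> n - \<Omega> (Suc n)) + a n * z * a (Suc n) * z * \<Theta> (Suc n)
     + b (Suc n) * c n * z * \<Theta> (Suc n) + b n * c n * z * \<Theta>s n - a n * z * a n * z * \<Theta> n - a n * W"
    using nz by (simp add: compat_xx_def field_simps)
  have compat_xu: "b n * compat_xu n = b n * (\<Omega> (Suc n) + \<Omega>s n) - b (Suc n) * a n * \<Theta> (Suc n)
     - b n * a (Suc n) * z * \<Theta> (Suc n) + b n * a n * (z * \<Theta> n - \<Theta>s n)"
    using nz by (simp add: compat_xu_def field_simps)
  have "W * dx (Suc n) = W * (a n * x n + a n * z * dx n + b n * du n)"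
    by (simp only: dx_Suc)
  also have "\<dots> = a n * W * x n + a n * z * (W * dx n) + b n * (W * du n)"
    by (simp add: algebra_simps)
  finally have "0 = a n * W * x n + a n * z * (\<Theta> n * x (Suc n) - (\<Omega> n + V) * x n)
       + b n * (- \<Theta>s n * u (Suc n) + (\<Omega>s n - V) * u n)
       - (\<Theta> (Suc n) * x (Suc (Suc n)) - (\<Omega> (Suc n) + V) * x (Suc n))"
    by (simp only: W_dx W_du diff_self)
  also have "\<dots> = - (a n * z) * compat_xx n * x n + b n * compat_xu n * u n"
    unfolding mult_minus_left compat_xu compat_xx x_Suc u_Suc by (simp add: algebra_simps)
  finally show ?thesis ..
qed

lemma u_compat: "- (c n * z) * compat_ux n * x n + a n * compat_uu n * u n = 0"
proof -
  have compat_ux: "c n * z * compat_ux n = c n * z * (\<Omega>s (Suc n) + \<Omega> n) - c n * z * a (Suc n) * \<Theta>s (Suc n)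
     - z * c (Suc n) * a n * z * \<Theta>s (Suc n) - c n * z * a n * (z * \<Theta> n - \<Theta>s n) - c n * W"
    using nz by (simp add: compat_ux_def field_simps)
  have compat_uu: "a n * compat_uu n = a n * (\<Omega>s n - \<Omega>s (Suc n)) + a n * a (Suc n) * \<Theta>s (Suc n)
     + c (Suc n) * b n * z * \<Theta>s (Suc n) + b n * c n * z * \<Theta> n - a n * a n * \<Theta>s n"
    using nz by (simp add: compat_uu_def field_simps)
  have "W * du (Suc n) = W * (a n * du n + c n * x n + c n * z * dx n)"
    by (simp only: du_Suc)
  also have "\<dots> = a n * (W * du n) + c n * W * x n + c n * z * (W * dx n)"
    by (simp add: algebra_simps)
  finally have "0 = a n * (- \<Theta>s n * u (Suc n) + (\<Omega>s n - V) * u n) + c n * W * x n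
       + c n * z * (\<Theta> n * x (Suc n) - (\<Omega> n + V) * x n)
       - (- \<Theta>s (Suc n) * u (Suc (Suc n)) + (\<Omega>s (Suc n) - V) * u (Suc n))"
    by (simp only: W_dx W_du diff_self)
  also have "\<dots> = - (c n * z) * compat_ux n * x n + a n * compat_uu n * u n"
    unfolding mult_minus_left compat_ux compat_uu x_Suc u_Suc by (simp add: algebra_simps)
  finally show ?thesis ..
qed

end

text \<open>The same comparison for a scalar three-term recurrence, expanded in the two later values.\<close>

lemma three_term_compat:
  fixes z :: "'a::field"
  assumes z: "z \<noteq> 0"
    and x2: "x2 = (r + q * z) * x1 - s * z * x0"
    and x3: "x3 = (r' + q' * z) * x2 - s' * z * x1"
    and dx2: "dx2 = q * x1 + (r + q * z) * dx1 - s * x0 - s * z * dx0"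
    and W_dx0: "W * dx0 = \<Theta>0 * x1 - (\<Omega>0 + V) * x0"
    and W_dx1: "W * dx1 = \<Theta>1 * x2 - (\<Omega>1 + V) * x1"
    and W_dx2: "W * dx2 = \<Theta>2 * x3 - (\<Omega>2 + V) * x2"
  shows "((r + q * z) * (\<Omega>0 - \<Omega>1) + s' * z * \<Theta>2 - s * z * \<Theta>0 - r * (W / z)) * x1
     + ((r + q * z) * \<Theta>1 + W / z - \<Omega>0 - (r' + q' * z) * \<Theta>2 + \<Omega>2) * x2 = 0"
proof -
  define k where "k = W / z"
  have W: "W = k * z" using z by (simp add: k_def)
  have "0 = q * W * x1 + (r + q * z) * (W * dx1) - s * W * x0 - s * z * (W * dx0) - W * dx2"
    unfolding dx2 by (simp add: algebra_simps)
  also have "\<dots> = q * W * x1 + (r + q * z) * (\<Theta>1 * x2 - (\<Omega>1 + V) * x1) - s * W * x0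
      - s * z * (\<Theta>0 * x1 - (\<Omega>0 + V) * x0) - (\<Theta>2 * x3 - (\<Omega>2 + V) * x2)"
    by (simp only: W_dx0 W_dx1 W_dx2)
  also have "\<dots> = ((r + q * z) * (\<Omega>0 - \<Omega>1) + s' * z * \<Theta>2 - s * z * \<Theta>0 - r * k) * x1
     + ((r + q * z) * \<Theta>1 + k - \<Omega>0 - (r' + q' * z) * \<Theta>2 + \<Omega>2) * x2"
    unfolding x3 x2 W by (simp add: algebra_simps)
  finally show ?thesis unfolding k_def ..
qed

context szego_solution
begin

text \<open>Elimination of \<open>u\<close> leaves a recurrence for \<open>x\<close> alone, in which \<open>unimodular\<close> simplifies the
coefficient of \<open>x n\<close>; the next lemmas do the same for \<open>u\<close> and for the formal derivatives.\<close>

lemma x_three_term: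
  "x (Suc (Suc n)) = (b (Suc n) * a n / b n + a (Suc n) * z) * x (Suc n) - b (Suc n) / b n * z * x n"
proof -
  have "b n * u (Suc n) = a n * (a n * z * x n + b n * u n) - (a n ^ 2 - b n * c n) * z * x n"
    by (simp add: u_Suc power2_eq_square algebra_simps)
  then have "u (Suc n) = (a n * x (Suc n) - z * x n) / b n"
    using nz by (simp add: unimodular x_Suc field_simps)
  then show ?thesis
    by (simp add: x_Suc[of "Suc n"] ring_distribs diff_divide_distrib mult_ac)
qed

lemma u_three_term:
  "u (Suc (Suc n)) = (a (Suc n) + c (Suc n) * a n / c n * z) * u (Suc n) - c (Suc n) / c n * z * u n"
proof -
  have "c n * x (Suc n) = a n * (a n * u n + c n * z * x n) - (a n ^ 2 - b n * c n) * u n"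
    by (simp add: x_Suc power2_eq_square algebra_simps)
  then have "x (Suc n) = (a n * u (Suc n) - u n) / c n"
    using nz by (simp add: unimodular u_Suc field_simps)
  then show ?thesis
    by (simp add: u_Suc[of "Suc n"] ring_distribs diff_divide_distrib mult_ac)
qed

lemma dx_three_term:
  "dx (Suc (Suc n)) = a (Suc n) * x (Suc n) + (b (Suc n) * a n / b n + a (Suc n) * z) * dx (Suc n)
     - b (Suc n) / b n * x n - b (Suc n) / b n * z * dx n"
proof -
  have "b n * du (Suc n) = a n * (a n * x n + a n * z * dx n + b n * du n)
     - (a n ^ 2 - b n * c n) * (x n + z * dx n)"
    by (simp add: du_Suc power2_eq_square algebra_simps)
  then have "du (Suc n) = (a n * dx (Suc n) - x n - z * dx n) / b n"
    using nz by (simp add: unimodular dx_Suc field_simps)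
  then show ?thesis
    by (simp add: dx_Suc[of "Suc n"] ring_distribs diff_divide_distrib mult_ac)
qed

lemma du_three_term:
  "du (Suc (Suc n)) = c (Suc n) * a n / c n * u (Suc n)
     + (a (Suc n) + c (Suc n) * a n / c n * z) * du (Suc n)
     - c (Suc n) / c n * u n - c (Suc n) / c n * z * du n"
proof -
  have "c n * (x (Suc n) + z * dx (Suc n)) = a n * (u (Suc n) + z * du (Suc n))
     - (a n ^ 2 - b n * c n) * (u n + z * du n)"
    by (simp add: x_Suc dx_Suc u_Suc du_Suc power2_eq_square algebra_simps)
  then have "x (Suc n) + z * dx (Suc n)
      = (a n * (u (Suc n) + z * du (Suc n)) - u n - z * du n) / c n"
    using nz by (simp add: unimodular field_simps)
  moreover have "du (Suc (Suc n)) = a (Suc n) * du (Suc n) + c (Suc n) * (x (Suc n) + z * dx (Suc n))"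
    by (simp add: du_Suc[of "Suc n"] algebra_simps)
  ultimately show ?thesis
    by (simp add: ring_distribs diff_divide_distrib add_divide_distrib mult_ac)
qed

text \<open>The coefficients that the three-term comparison yields for \<open>x\<close> and, up to sign, for \<open>u\<close>;
\<open>next\<close> marks the coefficient of the later value.\<close>

definition "three_term_x n = (b (Suc n) * a n / b n + a (Suc n) * z) * (\<Omega> n - \<Omega> (Suc n))
  + b (Suc (Suc n)) / b (Suc n) * z * \<Theta> (Suc (Suc n)) - b (Suc n) / b n * z * \<Theta> n
  - b (Suc n) * a n / b n * (W / z)"

definition "three_term_u n = (a (Suc n) + c (Suc n) * a n / c n * z) * (\<Omega>s n - \<Omega>s (Suc n))
  + c (Suc (Suc n)) / c (Suc n) * z * \<Theta>s (Suc (Suc n)) - c (Suc n) / c n * z * \<Theta>s n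
  + a (Suc n) * (W / z)"

definition "three_term_x_next n = (b (Suc n) * a n / b n + a (Suc n) * z) * \<Theta> (Suc n) + W / z - \<Omega> n
  - (b (Suc (Suc n)) * a (Suc n) / b (Suc n) + a (Suc (Suc n)) * z) * \<Theta> (Suc (Suc n))
  + \<Omega> (Suc (Suc n))"

definition "three_term_u_next n = - ((a (Suc n) + c (Suc n) * a n / c n * z) * \<Theta>s (Suc n)) + W / z + \<Omega>s n
  + (a (Suc (Suc n)) + c (Suc (Suc n)) * a (Suc n) / c (Suc n) * z) * \<Theta>s (Suc (Suc n))
  - \<Omega>s (Suc (Suc n))"

lemma x_three_term_compat: "three_term_x n * x (Suc n) + three_term_x_next n * x (Suc (Suc n)) = 0"
  unfolding three_term_x_def three_term_x_next_def
  by (rule three_term_compat[OF nz(1) x_three_term x_three_term dx_three_term W_dx W_dx W_dx])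

text \<open>The reflected functions obey relations of the same shape with \<open>\<Theta>\<^sup>*\<close> and \<open>\<Omega>\<^sup>*\<close> negated, so they are
another instance of the general three-term comparison.\<close>

lemma u_three_term_compat: "- three_term_u n * u (Suc n) + three_term_u_next n * u (Suc (Suc n)) = 0"
proof -
  have W_du': "W * du n = - \<Theta>s n * u (Suc n) - (- \<Omega>s n + V) * u n" for n
    by (simp add: W_du algebra_simps)
  have three_term_u: "- three_term_u n = (a (Suc n) + c (Suc n) * a n / c n * z) * (- \<Omega>s n - - \<Omega>s (Suc n))
      + c (Suc (Suc n)) / c (Suc n) * z * - \<Theta>s (Suc (Suc n)) - c (Suc n) / c n * z * - \<Theta>s n
      - a (Suc n) * (W / z)"
    unfolding three_term_u_def by (simp add: right_diff_distrib)
  have three_term_u_next: "three_term_u_next n = (a (Suc n) + c (Suc n) * a n / c n * z) * - \<Theta>s (Suc n) + W / z - - \<Omega>s n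
      - (a (Suc (Suc n)) + c (Suc (Suc n)) * a (Suc n) / c (Suc n) * z) * - \<Theta>s (Suc (Suc n))
      + - \<Omega>s (Suc (Suc n))"
    unfolding three_term_u_next_def by simp
  show ?thesis
    unfolding three_term_u three_term_u_next
    by (rule three_term_compat[OF nz(1) u_three_term u_three_term du_three_term W_du' W_du' W_du'])
qed

end

lemma independent_vanish:
  fixes x :: "'a::field"
  assumes "\<alpha> * x + \<beta> * u = 0" "\<alpha> * y + \<beta> * v = 0" "x * v - y * u \<noteq> 0"
  shows "\<alpha> = 0" "\<beta> = 0"
proof -
  have "\<alpha> * (x * v - y * u) = (\<alpha> * x + \<beta> * u) * v - (\<alpha> * y + \<beta> * v) * u"
    by (simp add: algebra_simps)
  then show "\<alpha> = 0" using assms by simp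
  have "\<beta> * (x * v - y * u) = (\<alpha> * y + \<beta> * v) * x - (\<alpha> * x + \<beta> * u) * y"
    by (simp add: algebra_simps)
  then show "\<beta> = 0" using assms by simp
qed

text \<open>Two solutions for opposite signs of \<open>V\<close> with a non-zero Casoratian. A linear relation
with common coefficients between their values must be trivial, which turns every comparison
above into equations for \<open>\<Theta>\<close>, \<open>\<Omega>\<close>, \<open>\<Theta>\<^sup>*\<close> and \<open>\<Omega>\<^sup>*\<close>.\<close>

locale szego_fundamental_pair =
  szego_solution a b c z W V \<Theta> \<Omega> \<Theta>s \<Omega>s x u dx du +
  second: szego_solution a b c z W "- V" \<Theta> \<Omega> \<Theta>s \<Omega>s y v dy dv
  for a b c :: "nat \<Rightarrow> 'a::field" and z W V :: 'a
    and \<Theta> \<Omega> \<Theta>s \<Omega>s x u dx du y v dy dv :: "nat \<Rightarrow> 'a" +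
  fixes d :: 'a
  assumes d_nz: "d \<noteq> 0"
    and wronskian: "x n * v n - y n * u n = d * z ^ n"
    and wronskian_deriv:
      "dx n * v n + x n * dv n - (dy n * u n + y n * du n) = d * (of_nat n * z ^ (n - 1))"
begin

lemma wronskian_nz: "x n * v n - y n * u n \<noteq> 0"
  unfolding wronskian using d_nz nz by simp

lemma compat_xu_eq_0: "compat_xu n = 0" and compat_xx_eq_0: "compat_xx n = 0"
  using independent_vanish[OF x_compat[of n] second.x_compat[of n] wronskian_nz] nz by auto

lemma compat_ux_eq_0: "compat_ux n = 0" and compat_uu_eq_0: "compat_uu n = 0"
  using independent_vanish[OF u_compat[of n] second.u_compat[of n] wronskian_nz] nz by auto

lemma three_term_x_eq_0: "three_term_x n = 0"
proof -
  have "x (Suc n) * y (Suc (Suc n)) - y (Suc n) * x (Suc (Suc n))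
      = b (Suc n) * (x (Suc n) * v (Suc n) - y (Suc n) * u (Suc n))"
    by (simp add: x_Suc[of "Suc n"] second.x_Suc[of "Suc n"] algebra_simps)
  then have "x (Suc n) * y (Suc (Suc n)) - y (Suc n) * x (Suc (Suc n)) \<noteq> 0"
    using wronskian_nz nz by simp
  then show ?thesis
    using independent_vanish[OF x_three_term_compat[of n] second.x_three_term_compat[of n]] by simp
qed

lemma three_term_u_eq_0: "three_term_u n = 0"
proof -
  have "u (Suc n) * v (Suc (Suc n)) - v (Suc n) * u (Suc (Suc n))
      = - c (Suc n) * z * (x (Suc n) * v (Suc n) - y (Suc n) * u (Suc n))"
    by (simp add: u_Suc[of "Suc n"] second.u_Suc[of "Suc n"] algebra_simps)
  then have "u (Suc n) * v (Suc (Suc n)) - v (Suc n) * u (Suc (Suc n)) \<noteq> 0"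
    using wronskian_nz nz by simp
  then show ?thesis
    using independent_vanish[OF u_three_term_compat[of n] second.u_three_term_compat[of n]] by simp
qed

text \<open>The differential relations form a first-order linear system for the pair \<open>(x n, u n)\<close>. By the formula of
Liouville, the logarithmic derivative of the Casoratian \<open>d z ^ n\<close>, times \<open>W\<close>, is the trace of
its matrix; the contributions of \<open>V\<close> and \<open>- V\<close> cancel.\<close>

lemma trace: "a n * (z * \<Theta> n - \<Theta>s n) + \<Omega>s n - \<Omega> n = of_nat n * (W / z)"
proof -
  have "(a n * (z * \<Theta> n - \<Theta>s n) + \<Omega>s n - \<Omega> n) * (d * z ^ n)
      = (W * dx n) * v n + x n * (W * dv n) - ((W * dy n) * u n + y n * (W * du n))"
    unfolding wronskian[symmetric] W_dx W_du second.W_dx second.W_du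
      x_Suc u_Suc second.x_Suc second.u_Suc by (simp add: algebra_simps)
  also have "\<dots> = W * (dx n * v n + x n * dv n - (dy n * u n + y n * du n))"
    by (simp add: algebra_simps)
  also have "\<dots> = of_nat n * (W / z) * (d * z ^ n)"
    unfolding wronskian_deriv using nz by (cases n) (simp_all add: field_simps)
  finally show ?thesis
    using d_nz nz(1) by (simp only: mult_right_cancel mult_eq_0_iff power_eq_0_iff not_False_eq_True simp_thms)
qed

lemma sum_relation_x:
  "\<Omega> (Suc n) + \<Omega> n - (b (Suc n) * a n / b n + a (Suc n) * z) * \<Theta> (Suc n) + of_nat n * (W / z) = 0"
  using compat_xu_eq_0[of n] unfolding trace[symmetric] compat_xu_def by (simp add: algebra_simps)

lemma sum_relation_u:
  "\<Omega>s (Suc n) + \<Omega>s n - (a (Suc n) + c (Suc n) * a n / c n * z) * \<Theta>s (Suc n)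
     - of_nat (Suc n) * (W / z) = 0"
proof -
  have eq: "of_nat (Suc n) * (W / z) = W / z + (a n * (z * \<Theta> n - \<Theta>s n) + \<Omega>s n - \<Omega> n)"
    unfolding trace by (simp only: of_nat_Suc distrib_right mult_1)
  then show ?thesis
    using compat_ux_eq_0[of n] unfolding eq compat_ux_def by (simp add: algebra_simps)
qed

end

section \<open>The associated functions as a fundamental pair\<close>

context circle_biorthogonal
begin

lemma casoratian_deriv:
  assumes z: "norm z \<noteq> 1"
  shows "poly (pderiv (\<phi> n)) z * assoc_eps_star w \<kappa> \<phi>b n z
      + poly (\<phi> n) z * deriv (assoc_eps_star w \<kappa> \<phi>b n) z
      + (deriv (assoc_eps w \<kappa> \<phi> n) z * poly (reflect_poly (\<phi>b n)) z
      + assoc_eps w \<kappa> \<phi> n z * poly (pderiv (reflect_poly (\<phi>b n))) z)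
    = 2 * (of_nat n * z ^ (n - 1))"
    (is "?D = _")
proof -
  let ?cas = "\<lambda>z. poly (\<phi> n) z * assoc_eps_star w \<kappa> \<phi>b n z
    + assoc_eps w \<kappa> \<phi> n z * poly (reflect_poly (\<phi>b n)) z"
  have "(?cas has_field_derivative ?D) (at z)"
    by (auto intro!: derivative_eq_intros assoc_eps_has_derivative[OF z]
        assoc_eps_star_has_derivative[OF z])
  moreover have "(?cas has_field_derivative 2 * (of_nat n * z ^ (n - 1))) (at z)"
    by (rule has_field_derivative_transform_within_open
          [of "\<lambda>z. 2 * z ^ n" _ _ "{z. norm z \<noteq> 1}"])
      (use z in \<open>auto intro!: derivative_eq_intros open_off_circle simp: casoratian\<close>)
  ultimately show ?thesis by (rule DERIV_unique)
qed

lemma assoc_eps_deriv_recurrence: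
  assumes z: "norm z \<noteq> 1"
  shows "\<kappa> n * deriv (assoc_eps w \<kappa> \<phi> (Suc n)) z
    = \<kappa> (Suc n) * (assoc_eps w \<kappa> \<phi> n z + z * deriv (assoc_eps w \<kappa> \<phi> n) z)
      - poly (\<phi> (Suc n)) 0 * deriv (assoc_eps_star w \<kappa> \<phi>b n) z"
    (is "_ = ?D")
proof -
  have "((\<lambda>z. \<kappa> n * assoc_eps w \<kappa> \<phi> (Suc n) z) has_field_derivative ?D) (at z)"
    by (rule has_field_derivative_transform_within_open
          [of "\<lambda>z. \<kappa> (Suc n) * z * assoc_eps w \<kappa> \<phi> n z
             - poly (\<phi> (Suc n)) 0 * assoc_eps_star w \<kappa> \<phi>b n z" _ _ "{z. norm z \<noteq> 1}"])
      (use z in \<open>auto intro!: derivative_eq_intros open_off_circle assoc_eps_has_derivative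
         assoc_eps_star_has_derivative simp: assoc_eps_recurrence algebra_simps\<close>)
  then show ?thesis
    using DERIV_cmult[OF assoc_eps_has_derivative[OF z]] by (metis DERIV_unique)
qed

lemma assoc_eps_star_deriv_recurrence:
  assumes z: "norm z \<noteq> 1"
  shows "\<kappa> n * deriv (assoc_eps_star w \<kappa> \<phi>b (Suc n)) z
    = \<kappa> (Suc n) * deriv (assoc_eps_star w \<kappa> \<phi>b n) z
      - poly (\<phi>b (Suc n)) 0 * (assoc_eps w \<kappa> \<phi> n z + z * deriv (assoc_eps w \<kappa> \<phi> n) z)"
    (is "_ = ?D")
proof -
  have "((\<lambda>z. \<kappa> n * assoc_eps_star w \<kappa> \<phi>b (Suc n) z) has_field_derivative ?D) (at z)"
    by (rule has_field_derivative_transform_within_open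
          [of "\<lambda>z. \<kappa> (Suc n) * assoc_eps_star w \<kappa> \<phi>b n z
             - poly (\<phi>b (Suc n)) 0 * z * assoc_eps w \<kappa> \<phi> n z" _ _ "{z. norm z \<noteq> 1}"])
      (use z in \<open>auto intro!: derivative_eq_intros open_off_circle assoc_eps_has_derivative
         assoc_eps_star_has_derivative simp: assoc_eps_star_recurrence algebra_simps\<close>)
  then show ?thesis
    using DERIV_cmult[OF assoc_eps_star_has_derivative[OF z]] by (metis DERIV_unique)
qed

text \<open>With the sign of \<open>\<epsilon>\<^sub>n\<^sup>*\<close> reversed, \<open>(\<epsilon>\<^sub>n, - \<epsilon>\<^sub>n\<^sup>*)\<close> solves the recurrences of
\<open>(\<phi>\<^sub>n, \<phi>\<^sub>n\<^sup>*)\<close>. The associated functions are Cauchy integrals and hence holomorphic off the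
circle, so their recurrences may be differentiated.\<close>

lemma szego_fundamental_pair_at:
  assumes z: "z \<in> D" "z \<noteq> 0" "norm z \<noteq> 1"
    and nz0: "\<And>n. poly (\<phi> n) 0 \<noteq> 0" "\<And>n. poly (\<phi>b n) 0 \<noteq> 0"
    and coeffs: "coefficient_functions D w \<kappa> \<phi> \<phi>b W V \<Theta> \<Omega> \<Theta>s \<Omega>s"
  shows "szego_fundamental_pair (\<lambda>n. \<kappa> (Suc n) / \<kappa> n) (\<lambda>n. poly (\<phi> (Suc n)) 0 / \<kappa> n)
    (\<lambda>n. poly (\<phi>b (Suc n)) 0 / \<kappa> n) z (W z) (V z)
    (\<lambda>n. \<Theta> n z) (\<lambda>n. \<Omega> n z) (\<lambda>n. \<Theta>s n z) (\<lambda>n. \<Omega>s n z)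
    (\<lambda>n. poly (\<phi> n) z) (\<lambda>n. poly (reflect_poly (\<phi>b n)) z)
    (\<lambda>n. poly (pderiv (\<phi> n)) z) (\<lambda>n. poly (pderiv (reflect_poly (\<phi>b n))) z)
    (\<lambda>n. assoc_eps w \<kappa> \<phi> n z) (\<lambda>n. - assoc_eps_star w \<kappa> \<phi>b n z)
    (\<lambda>n. deriv (assoc_eps w \<kappa> \<phi> n) z) (\<lambda>n. - deriv (assoc_eps_star w \<kappa> \<phi>b n) z) (- 2)"
proof
  note [simp] = \<kappa>_nz
  fix n
  let ?k = "\<kappa> n" and ?k' = "\<kappa> (Suc n)"
  let ?f = "poly (\<phi> (Suc n)) 0" and ?g = "poly (\<phi>b (Suc n)) 0"
  show "(?k' / ?k)\<^sup>2 - ?f / ?k * (?g / ?k) = 1"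
    using kappa_squared[of n] by (simp add: divide_simps power2_eq_square)
  have "?k * poly (\<phi> (Suc n)) z = ?k' * z * poly (\<phi> n) z + ?f * poly (reflect_poly (\<phi>b n)) z"
    using arg_cong[OF szego_recurrence[of n], of "\<lambda>p. poly p z"] by simp
  then show "poly (\<phi> (Suc n)) z
      = ?k' / ?k * z * poly (\<phi> n) z + ?f / ?k * poly (reflect_poly (\<phi>b n)) z"
    by (simp add: field_simps)
  have "?k * poly (reflect_poly (\<phi>b (Suc n))) z
      = ?k' * poly (reflect_poly (\<phi>b n)) z + ?g * z * poly (\<phi> n) z"
    using arg_cong[OF szego_recurrence_reflected[of n], of "\<lambda>p. poly p z"] by simp
  then show "poly (reflect_poly (\<phi>b (Suc n))) z
      = ?k' / ?k * poly (reflect_poly (\<phi>b n)) z + ?g / ?k * z * poly (\<phi> n) z"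
    by (simp add: field_simps)
  have "?k * poly (pderiv (\<phi> (Suc n))) z
      = ?k' * (poly (\<phi> n) z + z * poly (pderiv (\<phi> n)) z)
        + ?f * poly (pderiv (reflect_poly (\<phi>b n))) z"
    using arg_cong[OF szego_recurrence[of n], of "\<lambda>p. poly (pderiv p) z"]
    by (simp add: pderiv_smult pderiv_add pderiv_pCons algebra_simps)
  then show "poly (pderiv (\<phi> (Suc n))) z
      = ?k' / ?k * poly (\<phi> n) z + ?k' / ?k * z * poly (pderiv (\<phi> n)) z
        + ?f / ?k * poly (pderiv (reflect_poly (\<phi>b n))) z"
    by (simp add: field_simps)
  have "?k * poly (pderiv (reflect_poly (\<phi>b (Suc n)))) z
      = ?k' * poly (pderiv (reflect_poly (\<phi>b n))) z
        + ?g * (poly (\<phi> n) z + z * poly (pderiv (\<phi> n)) z)"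
    using arg_cong[OF szego_recurrence_reflected[of n], of "\<lambda>p. poly (pderiv p) z"]
    by (simp add: pderiv_smult pderiv_add pderiv_pCons algebra_simps)
  then show "poly (pderiv (reflect_poly (\<phi>b (Suc n)))) z
      = ?k' / ?k * poly (pderiv (reflect_poly (\<phi>b n))) z + ?g / ?k * poly (\<phi> n) z
        + ?g / ?k * z * poly (pderiv (\<phi> n)) z"
    by (simp add: field_simps)
  show "assoc_eps w \<kappa> \<phi> (Suc n) z
      = ?k' / ?k * z * assoc_eps w \<kappa> \<phi> n z + ?f / ?k * - assoc_eps_star w \<kappa> \<phi>b n z"
    using assoc_eps_recurrence[OF z(3), of n] by (simp add: field_simps)
  show "- assoc_eps_star w \<kappa> \<phi>b (Suc n) z
      = ?k' / ?k * - assoc_eps_star w \<kappa> \<phi>b n z + ?g / ?k * z * assoc_eps w \<kappa> \<phi> n z"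
    using assoc_eps_star_recurrence[OF z(3), of n] by (simp add: field_simps)
  show "deriv (assoc_eps w \<kappa> \<phi> (Suc n)) z
      = ?k' / ?k * assoc_eps w \<kappa> \<phi> n z + ?k' / ?k * z * deriv (assoc_eps w \<kappa> \<phi> n) z
        + ?f / ?k * - deriv (assoc_eps_star w \<kappa> \<phi>b n) z"
  proof -
    have "deriv (assoc_eps w \<kappa> \<phi> (Suc n)) z
        = (?k' * (assoc_eps w \<kappa> \<phi> n z + z * deriv (assoc_eps w \<kappa> \<phi> n) z)
          - ?f * deriv (assoc_eps_star w \<kappa> \<phi>b n) z) / ?k"
      using assoc_eps_deriv_recurrence[OF z(3), of n] by (simp add: nonzero_eq_divide_eq mult.commute)
    then show ?thesis
      by (simp add: add_divide_distrib diff_divide_distrib distrib_left mult_ac)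
  qed
  show "- deriv (assoc_eps_star w \<kappa> \<phi>b (Suc n)) z
      = ?k' / ?k * - deriv (assoc_eps_star w \<kappa> \<phi>b n) z + ?g / ?k * assoc_eps w \<kappa> \<phi> n z
        + ?g / ?k * z * deriv (assoc_eps w \<kappa> \<phi> n) z"
    using assoc_eps_star_deriv_recurrence[OF z(3), of n] by (simp add: field_simps)
  show "poly (\<phi> n) z * - assoc_eps_star w \<kappa> \<phi>b n z
      - assoc_eps w \<kappa> \<phi> n z * poly (reflect_poly (\<phi>b n)) z = - 2 * z ^ n"
    using casoratian[OF z(3), of n] by (simp add: algebra_simps)
  show "poly (pderiv (\<phi> n)) z * - assoc_eps_star w \<kappa> \<phi>b n z
      + poly (\<phi> n) z * - deriv (assoc_eps_star w \<kappa> \<phi>b n) z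
      - (deriv (assoc_eps w \<kappa> \<phi> n) z * poly (reflect_poly (\<phi>b n)) z
        + assoc_eps w \<kappa> \<phi> n z * poly (pderiv (reflect_poly (\<phi>b n))) z)
      = - 2 * (of_nat n * z ^ (n - 1))"
    using casoratian_deriv[OF z(3), of n] by (simp add: algebra_simps)
qed (use z nz0 coeffs \<kappa>_nz in \<open>simp_all add: coefficient_functions_def phi_star_def\<close>)

end

section \<open>The recurrence relations of the coefficient functions\<close>

theorem proposition2p7:
  fixes D :: "complex set"
    and w W V :: "complex \<Rightarrow> complex"
    and \<kappa> :: "nat \<Rightarrow> complex"
    and \<phi> \<phi>b :: "nat \<Rightarrow> complex poly"
    and \<Theta> \<Omega> \<Theta>s \<Omega>s :: "nat \<Rightarrow> complex \<Rightarrow> complex"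
  assumes "admissible_weight D w"
    and "biorthonormal w \<kappa> \<phi> \<phi>b"
    and "\<forall>n. poly (\<phi> n) 0 \<noteq> 0 \<and> poly (\<phi>b n) 0 \<noteq> 0"
    and "\<exists>z\<in>D. W z \<noteq> 0"
    and "\<forall>z\<in>D. W z * deriv w z = 2 * V z * w z"
    and "coefficient_functions D w \<kappa> \<phi> \<phi>b W V \<Theta> \<Omega> \<Theta>s \<Omega>s"
  shows "\<forall>z\<in>D. z \<noteq> 0 \<and> norm z \<noteq> 1 \<longrightarrow>
    (\<forall>n\<ge>1.
      \<Omega> n z + \<Omega> (n - 1) z
        - (poly (\<phi> (n + 1)) 0 / poly (\<phi> n) 0 + \<kappa> (n + 1) / \<kappa> n * z) * \<Theta> n z
        + of_nat (n - 1) * (W z / z) = 0 \<and>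
      (poly (\<phi> (n + 1)) 0 / poly (\<phi> n) 0 + \<kappa> (n + 1) / \<kappa> n * z) * (\<Omega> (n - 1) z - \<Omega> n z)
        + (\<kappa> n * poly (\<phi> (n + 2)) 0) / (\<kappa> (n + 1) * poly (\<phi> (n + 1)) 0) * z * \<Theta> (n + 1) z
        - (\<kappa> (n - 1) * poly (\<phi> (n + 1)) 0) / (\<kappa> n * poly (\<phi> n) 0) * z * \<Theta> (n - 1) z
        - poly (\<phi> (n + 1)) 0 / poly (\<phi> n) 0 * (W z / z) = 0 \<and>
      \<Omega>s n z + \<Omega>s (n - 1) z
        - (\<kappa> (n + 1) / \<kappa> n + poly (\<phi>b (n + 1)) 0 / poly (\<phi>b n) 0 * z) * \<Theta>s n z
        - of_nat n * (W z / z) = 0 \<and>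
      (\<kappa> (n + 1) / \<kappa> n + poly (\<phi>b (n + 1)) 0 / poly (\<phi>b n) 0 * z) * (\<Omega>s (n - 1) z - \<Omega>s n z)
        + (\<kappa> n * poly (\<phi>b (n + 2)) 0) / (\<kappa> (n + 1) * poly (\<phi>b (n + 1)) 0) * z * \<Theta>s (n + 1) z
        - (\<kappa> (n - 1) * poly (\<phi>b (n + 1)) 0) / (\<kappa> n * poly (\<phi>b n) 0) * z * \<Theta>s (n - 1) z
        + \<kappa> (n + 1) / \<kappa> n * (W z / z) = 0) \<and>
    (\<forall>n.
      \<Omega> (n + 1) z + \<Omega>s n z
        - (poly (\<phi> (n + 2)) 0 / poly (\<phi> (n + 1)) 0 + \<kappa> (n + 2) / \<kappa> (n + 1) * z) * \<Theta> (n + 1) z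
        + \<kappa> (n + 1) / \<kappa> n * (z * \<Theta> n z - \<Theta>s n z) = 0 \<and>
      \<Omega> n z - \<Omega> (n + 1) z
        + \<kappa> (n + 2) / \<kappa> (n + 1)
          * (z + poly (\<phi>b (n + 1)) 0 / \<kappa> (n + 1) * (poly (\<phi> (n + 2)) 0 / \<kappa> (n + 2))) * \<Theta> (n + 1) z
        + (poly (\<phi> (n + 1)) 0 * poly (\<phi>b (n + 1)) 0) / (\<kappa> (n + 1) * \<kappa> n) * \<Theta>s n z
        - \<kappa> (n + 1) / \<kappa> n * z * \<Theta> n z
        - W z / z = 0 \<and>
      \<Omega>s (n + 1) z + \<Omega> n z
        - (\<kappa> (n + 2) / \<kappa> (n + 1) + poly (\<phi>b (n + 2)) 0 / poly (\<phi>b (n + 1)) 0 * z) * \<Theta>s (n + 1) z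
        - \<kappa> (n + 1) / \<kappa> n * (z * \<Theta> n z - \<Theta>s n z)
        - W z / z = 0 \<and>
      \<Omega>s n z - \<Omega>s (n + 1) z
        + \<kappa> (n + 2) / \<kappa> (n + 1)
          * (1 + poly (\<phi> (n + 1)) 0 / \<kappa> (n + 1) * (poly (\<phi>b (n + 2)) 0 / \<kappa> (n + 2)) * z) * \<Theta>s (n + 1) z
        + (poly (\<phi> (n + 1)) 0 * poly (\<phi>b (n + 1)) 0) / (\<kappa> (n + 1) * \<kappa> n) * z * \<Theta> n z
        - \<kappa> (n + 1) / \<kappa> n * \<Theta>s n z = 0)"
proof (intro ballI impI, goal_cases)
  case (1 z)
  then have "z \<in> D" and z: "z \<noteq> 0 \<and> norm z \<noteq> 1" by auto
  obtain r R where "0 \<le> r" "r < 1" "1 < R" and laurent: "\<forall>z. r < norm z \<and> norm z < R \<longrightarrow>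
      ((\<lambda>k::int. weight_coeff w k * z powi k) has_sum w z) UNIV"
    using assms(1) unfolding admissible_weight_def by blast
  have "circ_cont w"
    by (rule continuous_on_circle_Laurent[of "weight_coeff w"])
      (use laurent \<open>r < 1\<close> \<open>1 < R\<close> in auto)
  then interpret circle_biorthogonal w \<kappa> \<phi> \<phi>b
    using assms(2) by unfold_locales
  have nz0: "poly (\<phi> n) 0 \<noteq> 0" "poly (\<phi>b n) 0 \<noteq> 0" for n
    using assms(3) by auto
  interpret szego_fundamental_pair "\<lambda>n. \<kappa> (Suc n) / \<kappa> n" "\<lambda>n. poly (\<phi> (Suc n)) 0 / \<kappa> n"
    "\<lambda>n. poly (\<phi>b (Suc n)) 0 / \<kappa> n" z "W z" "V z"
    "\<lambda>n. \<Theta> n z" "\<lambda>n. \<Omega> n z" "\<lambda>n. \<Theta>s n z" "\<lambda>n. \<Omega>s n z"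
    "\<lambda>n. poly (\<phi> n) z" "\<lambda>n. poly (reflect_poly (\<phi>b n)) z"
    "\<lambda>n. poly (pderiv (\<phi> n)) z" "\<lambda>n. poly (pderiv (reflect_poly (\<phi>b n))) z"
    "\<lambda>n. assoc_eps w \<kappa> \<phi> n z" "\<lambda>n. - assoc_eps_star w \<kappa> \<phi>b n z"
    "\<lambda>n. deriv (assoc_eps w \<kappa> \<phi> n) z" "\<lambda>n. - deriv (assoc_eps_star w \<kappa> \<phi>b n) z" "- 2"
    by (rule szego_fundamental_pair_at) (use \<open>z \<in> D\<close> z nz0 assms(6) in auto)
  note [simp] = \<kappa>_nz nz0
  let ?f = "\<lambda>n. poly (\<phi> n) 0" and ?g = "\<lambda>n. poly (\<phi>b n) 0"
  \<comment> \<open>cancelling \<open>\<kappa> n\<close> from quotients of the recurrence coefficients leaves the coefficients of the claim\<close>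
  have ratio [simp]:
    "?f (Suc (Suc n)) / \<kappa> (Suc n) * (\<kappa> (Suc n) / \<kappa> n) / (?f (Suc n) / \<kappa> n)
       = ?f (Suc (Suc n)) / ?f (Suc n)"
    "?g (Suc (Suc n)) / \<kappa> (Suc n) * (\<kappa> (Suc n) / \<kappa> n) / (?g (Suc n) / \<kappa> n)
       = ?g (Suc (Suc n)) / ?g (Suc n)"
    "?f (Suc (Suc n)) / \<kappa> (Suc n) / (?f (Suc n) / \<kappa> n)
       = \<kappa> n * ?f (Suc (Suc n)) / (\<kappa> (Suc n) * ?f (Suc n))"
    "?g (Suc (Suc n)) / \<kappa> (Suc n) / (?g (Suc n) / \<kappa> n)
       = \<kappa> n * ?g (Suc (Suc n)) / (\<kappa> (Suc n) * ?g (Suc n))"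
    "?f (Suc n) / \<kappa> n * (?g (Suc n) / \<kappa> n) / (\<kappa> (Suc n) / \<kappa> n)
       = ?f (Suc n) * ?g (Suc n) / (\<kappa> (Suc n) * \<kappa> n)"
    "?f (Suc (Suc n)) / \<kappa> (Suc n) * (?g (Suc n) / \<kappa> n) / (\<kappa> (Suc n) / \<kappa> n)
       = \<kappa> (Suc (Suc n)) / \<kappa> (Suc n) * (?g (Suc n) / \<kappa> (Suc n) * (?f (Suc (Suc n)) / \<kappa> (Suc (Suc n))))"
    "?g (Suc (Suc n)) / \<kappa> (Suc n) * (?f (Suc n) / \<kappa> n) / (\<kappa> (Suc n) / \<kappa> n)
       = \<kappa> (Suc (Suc n)) / \<kappa> (Suc n) * (?f (Suc n) / \<kappa> (Suc n) * (?g (Suc (Suc n)) / \<kappa> (Suc (Suc n))))"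
    for n by (simp_all add: divide_simps)
  note eq1 = sum_relation_x[unfolded ratio]
  note eq2 = three_term_x_eq_0[unfolded three_term_x_def ratio]
  note eq3 = sum_relation_u[unfolded ratio]
  note eq4 = three_term_u_eq_0[unfolded three_term_u_def ratio]
  note eq5 = compat_xu_eq_0[unfolded compat_xu_def ratio]
  note eq6 = compat_xx_eq_0[unfolded compat_xx_def ratio, folded distrib_left]
  note eq7 = compat_ux_eq_0[unfolded compat_ux_def ratio]
  note eq8 = compat_uu_eq_0[unfolded compat_uu_def ratio]
  show ?case
  proof (intro conjI allI impI, goal_cases)
    case (1 n)
    then obtain m where n: "n = Suc m" by (cases n) auto
    show ?case using eq1[of m] by (simp add: n)
  next
    case (2 n)
    then obtain m where n: "n = Suc m" by (cases n) auto
    show ?case using eq2[of m] by (simp add: n)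
  next
    case (3 n)
    then obtain m where n: "n = Suc m" by (cases n) auto
    show ?case using eq3[of m] by (simp add: n)
  next
    case (4 n)
    then obtain m where n: "n = Suc m" by (cases n) auto
    show ?case using eq4[of m] by (simp add: n)
  next
    case (5 n) show ?case using eq5[of n] by simp
  next
    case (6 n) show ?case using eq6[of n] by (simp add: distrib_left mult.assoc)
  next
    case (7 n) show ?case using eq7[of n] by simp
  next
    case (8 n) show ?case using eq8[of n] by (simp add: distrib_left mult.assoc)
  qed
qed

end
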